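(* Let $\mathbb{X}$ and $\mathbb{A}$ be double categories. A double functor $F\colon\mathbb{X}\to\mathbb{A}$ admits a horizontal right double adjoint if and only if the parameterized presheaf on $\mathbb{X}$ $$\mathbb{A}(F-,-)\colon\mathbb{X}^{\mathrm{horop}}\times\mathbb{V}_1\mathbb{A}\to\mathbb{S}\mathrm{pan}^t$$ is represented by a double functor $G_0\colon\mathbb{V}_1\mathbb{A}\to\mathbb{X}$, i.e. for some double functor $G_0\colon\mathbb{V}_1\mathbb{A}\to\mathbb{X}$ it is isomorphic, as a parameterized presheaf, to $\mathbb{X}(-,G_0-)\colon\mathbb{X}^{\mathrm{horop}}\times\mathbb{V}_1\mathbb{A}\to\mathbb{S}\mathrm{pan}^t$.
   Context: **Double categories.** Double categories are strict (internal categories in $\mathbf{Cat}$): objects, horizontal morphisms, vertical morphisms, squares. $[\alpha\ \beta]$ denotes horizontal composition ($\alpha$ on the left), $\begin{bmatrix}\alpha\\ \beta\end{bmatrix}$ vertical composition ($\alpha$ on top); $1^v_C$ is the vertical identity, $i^v_f$ the vertical identity square of a horizontal morphism $f$. $\mathbb{D}(j,k)$ is the set of squares with left side $j$ and right side $k$. $\mathbb{D}^{\mathrm{horop}}$ reverses the horizontal direction. $\mathbb{V}_1\mathbb{D}$ has the same objects and vertical morphisms as $\mathbb{D}$ but only identity horizontal morphisms and trivial squares. **Horizontal double adjunction.** An adjunction in the 2-category of double categories, double functors and horizontal natural transformations. A horizontal natural transformation $\theta\colon F\Rightarrow G$ assigns to each object $A$ a horizontal morphism $\theta_A\colon FA\to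 GA$ and to each vertical morphism $j\colon A\to C$ a square $\theta_j$ with left $Fj$, right $Gj$, top $\theta_A$, bottom $\theta_C$, such that $\theta_{1^v_A}=i^v_{\theta_A}$, $\theta$ preserves vertical composition, and $[F\alpha\ \theta_k]=[\theta_j\ G\alpha]$ for each square $\alpha$ with left $j$, right $k$. **Parameterized presheaves.** $\mathbb{S}\mathrm{pan}^t$ has sets as objects, functions as horizontal morphisms, spans as (weakly associative, by pullback) vertical morphisms, and morphisms of spans as squares. A presheaf on $\mathbb{X}$ parameterized by $\mathbb{E}$ is a vertically lax double functor $K\colon\mathbb{X}^{\mathrm{horop}}\times\mathbb{E}\to\mathbb{S}\mathrm{pan}^t$: sets $K(C)$ for objects, functions $K(f)$ for horizontal morphisms, spans $K(C)\leftarrow K(j)\to K(C')$ for vertical $j\colon C\to C'$, morphisms of spans $K(\alpha)$ for squares, strictly functorial horizontally, with span maps $K(j)\times_{K(C')}K(k)\to K\left(\begin{bmatrix}j\\ k\end{bmatrix}\right)$ and $K(C)\to K(1^v_C)$, natural with respect to squares and horizontal morphisms, associative and unital. A morphism of such presheaves is a horizontal natural transformation: functions $K(C)\to L(C)$, $K(j)\to L(j)$ forming span morphisms, natural with respect to horizontal morphisms and squares, commuting with the comparison maps. $\mathbb{A}(F-,-)$ sends $(X,A)$ to the set of horizontal morphisms $FX\to A$ and vertical $(j,k)$ to the span $\mathbb{A}(Fj,k)$ with top and bottom boundary as legs; horizontal morphisms and squares act by horizontal composition; the comparison maps are vertical composition of squares and $f\mapsto i^v_f$. $\mathbb{X}(-,G_0-)$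 is analogous. *)

theory Defs
  imports Main
begin

section \<open>Strict double categories\<close>

text \<open>
  Composition is written in diagrammatic order throughout: \<open>comp f g\<close> is \<open>f\<close> followed by \<open>g\<close>,
  and it is only constrained on composable pairs of elements of the carriers.
\<close>

locale small_category =
  fixes Ob :: "'o set" and Ar :: "'m set"
    and src :: "'m \<Rightarrow> 'o" and tgt :: "'m \<Rightarrow> 'o"
    and ide :: "'o \<Rightarrow> 'm" and comp :: "'m \<Rightarrow> 'm \<Rightarrow> 'm"
  assumes src_closed: "f \<in> Ar \<Longrightarrow> src f \<in> Ob"
    and tgt_closed: "f \<in> Ar \<Longrightarrow> tgt f \<in> Ob"
    and ide_closed: "a \<in> Ob \<Longrightarrow> ide a \<in> Ar"
    and src_ide: "a \<in> Ob \<Longrightarrow> src (ide a) = a"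
    and tgt_ide: "a \<in> Ob \<Longrightarrow> tgt (ide a) = a"
    and comp_closed: "\<lbrakk>f \<in> Ar; g \<in> Ar; tgt f = src g\<rbrakk> \<Longrightarrow> comp f g \<in> Ar"
    and src_comp: "\<lbrakk>f \<in> Ar; g \<in> Ar; tgt f = src g\<rbrakk> \<Longrightarrow> src (comp f g) = src f"
    and tgt_comp: "\<lbrakk>f \<in> Ar; g \<in> Ar; tgt f = src g\<rbrakk> \<Longrightarrow> tgt (comp f g) = tgt g"
    and comp_ide_left: "f \<in> Ar \<Longrightarrow> comp (ide (src f)) f = f"
    and comp_ide_right: "f \<in> Ar \<Longrightarrow> comp f (ide (tgt f)) = f"
    and comp_assoc: "\<lbrakk>f \<in> Ar; g \<in> Ar; h \<in> Ar; tgt f = src g; tgt g = src h\<rbrakk>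
      \<Longrightarrow> comp (comp f g) h = comp f (comp g h)"

text \<open>
  \<open>hcomp\<close> and \<open>vcomp\<close> compose horizontal, respectively vertical, morphisms. For squares,
  \<open>sqh \<alpha> \<beta>\<close> is $[\alpha\ \beta]$ (\<open>\<alpha>\<close> on the left) and \<open>sqv \<alpha> \<beta>\<close> is the vertical composite
  with \<open>\<alpha>\<close> on top. \<open>hid C\<close> and \<open>vid C\<close> are the identity morphisms of an object,
  \<open>sqhid j\<close> is the horizontal identity square of a vertical morphism \<open>j\<close>, and \<open>sqvid f\<close> is the
  vertical identity square $i^v_f$ of a horizontal morphism \<open>f\<close>.
\<close>

record ('o, 'h, 'v, 's) dblcat =
  Obj :: "'o set"
  Hor :: "'h set"
  Ver :: "'v set"
  Sq :: "'s set"
  hdom :: "'h \<Rightarrow> 'o"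
  hcod :: "'h \<Rightarrow> 'o"
  hid :: "'o \<Rightarrow> 'h"
  hcomp :: "'h \<Rightarrow> 'h \<Rightarrow> 'h"
  vdom :: "'v \<Rightarrow> 'o"
  vcod :: "'v \<Rightarrow> 'o"
  vid :: "'o \<Rightarrow> 'v"
  vcomp :: "'v \<Rightarrow> 'v \<Rightarrow> 'v"
  sleft :: "'s \<Rightarrow> 'v"
  sright :: "'s \<Rightarrow> 'v"
  sqhid :: "'v \<Rightarrow> 's"
  sqh :: "'s \<Rightarrow> 's \<Rightarrow> 's"
  stop :: "'s \<Rightarrow> 'h"
  sbot :: "'s \<Rightarrow> 'h"
  sqvid :: "'h \<Rightarrow> 's"
  sqv :: "'s \<Rightarrow> 's \<Rightarrow> 's"

locale double_category =
  fixes D :: "('o, 'h, 'v, 's) dblcat"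
  assumes hor_category: "small_category (Obj D) (Hor D) (hdom D) (hcod D) (hid D) (hcomp D)"
    and ver_category: "small_category (Obj D) (Ver D) (vdom D) (vcod D) (vid D) (vcomp D)"
    and sqh_category: "small_category (Ver D) (Sq D) (sleft D) (sright D) (sqhid D) (sqh D)"
    and sqv_category: "small_category (Hor D) (Sq D) (stop D) (sbot D) (sqvid D) (sqv D)"
    and corner_top_left: "\<alpha> \<in> Sq D \<Longrightarrow> hdom D (stop D \<alpha>) = vdom D (sleft D \<alpha>)"
    and corner_top_right: "\<alpha> \<in> Sq D \<Longrightarrow> hcod D (stop D \<alpha>) = vdom D (sright D \<alpha>)"
    and corner_bot_left: "\<alpha> \<in> Sq D \<Longrightarrow> hdom D (sbot D \<alpha>) = vcod D (sleft D \<alpha>)"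
    and corner_bot_right: "\<alpha> \<in> Sq D \<Longrightarrow> hcod D (sbot D \<alpha>) = vcod D (sright D \<alpha>)"
    and stop_sqhid: "j \<in> Ver D \<Longrightarrow> stop D (sqhid D j) = hid D (vdom D j)"
    and sbot_sqhid: "j \<in> Ver D \<Longrightarrow> sbot D (sqhid D j) = hid D (vcod D j)"
    and stop_sqh: "\<lbrakk>\<alpha> \<in> Sq D; \<beta> \<in> Sq D; sright D \<alpha> = sleft D \<beta>\<rbrakk>
      \<Longrightarrow> stop D (sqh D \<alpha> \<beta>) = hcomp D (stop D \<alpha>) (stop D \<beta>)"
    and sbot_sqh: "\<lbrakk>\<alpha> \<in> Sq D; \<beta> \<in> Sq D; sright D \<alpha> = sleft D \<beta>\<rbrakk>
      \<Longrightarrow> sbot D (sqh D \<alpha> \<beta>) = hcomp D (sbot D \<alpha>) (sbot D \<beta>)"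
    and sleft_sqvid: "f \<in> Hor D \<Longrightarrow> sleft D (sqvid D f) = vid D (hdom D f)"
    and sright_sqvid: "f \<in> Hor D \<Longrightarrow> sright D (sqvid D f) = vid D (hcod D f)"
    and sleft_sqv: "\<lbrakk>\<alpha> \<in> Sq D; \<beta> \<in> Sq D; sbot D \<alpha> = stop D \<beta>\<rbrakk>
      \<Longrightarrow> sleft D (sqv D \<alpha> \<beta>) = vcomp D (sleft D \<alpha>) (sleft D \<beta>)"
    and sright_sqv: "\<lbrakk>\<alpha> \<in> Sq D; \<beta> \<in> Sq D; sbot D \<alpha> = stop D \<beta>\<rbrakk>
      \<Longrightarrow> sright D (sqv D \<alpha> \<beta>) = vcomp D (sright D \<alpha>) (sright D \<beta>)"
    and sqhid_vid: "C \<in> Obj D \<Longrightarrow> sqhid D (vid D C) = sqvid D (hid D C)"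
    and sqhid_vcomp: "\<lbrakk>j \<in> Ver D; k \<in> Ver D; vcod D j = vdom D k\<rbrakk>
      \<Longrightarrow> sqhid D (vcomp D j k) = sqv D (sqhid D j) (sqhid D k)"
    and sqvid_hcomp: "\<lbrakk>f \<in> Hor D; g \<in> Hor D; hcod D f = hdom D g\<rbrakk>
      \<Longrightarrow> sqvid D (hcomp D f g) = sqh D (sqvid D f) (sqvid D g)"
    and interchange: "\<lbrakk>\<alpha> \<in> Sq D; \<beta> \<in> Sq D; \<gamma> \<in> Sq D; \<delta> \<in> Sq D;
        sright D \<alpha> = sleft D \<beta>; sright D \<gamma> = sleft D \<delta>;
        sbot D \<alpha> = stop D \<gamma>; sbot D \<beta> = stop D \<delta>\<rbrakk>
      \<Longrightarrow> sqv D (sqh D \<alpha> \<beta>) (sqh D \<gamma> \<delta>) = sqh D (sqv D \<alpha> \<gamma>) (sqv D \<beta> \<delta>)"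

definition horop :: "('o, 'h, 'v, 's) dblcat \<Rightarrow> ('o, 'h, 'v, 's) dblcat" where
  "horop D = D\<lparr>hdom := hcod D, hcod := hdom D, hcomp := (\<lambda>f g. hcomp D g f),
     sleft := sright D, sright := sleft D, sqh := (\<lambda>\<alpha> \<beta>. sqh D \<beta> \<alpha>)\<rparr>"

definition dblprod ::
  "('o, 'h, 'v, 's) dblcat \<Rightarrow> ('o2, 'h2, 'v2, 's2) dblcat
    \<Rightarrow> ('o \<times> 'o2, 'h \<times> 'h2, 'v \<times> 'v2, 's \<times> 's2) dblcat" (infixr \<open>\<times>\<^sub>d\<close> 80) where
  "D \<times>\<^sub>d E = \<lparr>
     Obj = Obj D \<times> Obj E,
     Hor = Hor D \<times> Hor E,
     Ver = Ver D \<times> Ver E,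
     Sq = Sq D \<times> Sq E,
     hdom = map_prod (hdom D) (hdom E),
     hcod = map_prod (hcod D) (hcod E),
     hid = map_prod (hid D) (hid E),
     hcomp = (\<lambda>(f, f') (g, g'). (hcomp D f g, hcomp E f' g')),
     vdom = map_prod (vdom D) (vdom E),
     vcod = map_prod (vcod D) (vcod E),
     vid = map_prod (vid D) (vid E),
     vcomp = (\<lambda>(j, j') (k, k'). (vcomp D j k, vcomp E j' k')),
     sleft = map_prod (sleft D) (sleft E),
     sright = map_prod (sright D) (sright E),
     sqhid = map_prod (sqhid D) (sqhid E),
     sqh = (\<lambda>(\<alpha>, \<alpha>') (\<beta>, \<beta>'). (sqh D \<alpha> \<beta>, sqh E \<alpha>' \<beta>')),
     stop = map_prod (stop D) (stop E),
     sbot = map_prod (sbot D) (sbot E),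
     sqvid = map_prod (sqvid D) (sqvid E),
     sqv = (\<lambda>(\<alpha>, \<alpha>') (\<beta>, \<beta>'). (sqv D \<alpha> \<beta>, sqv E \<alpha>' \<beta>'))\<rparr>"

text \<open>$\mathbb{V}_1$: the trivial squares are the horizontal identity squares of vertical morphisms.\<close>

definition V1 :: "('o, 'h, 'v, 's) dblcat \<Rightarrow> ('o, 'h, 'v, 's) dblcat" where
  "V1 D = D\<lparr>Hor := hid D ` Obj D, Sq := sqhid D ` Ver D\<rparr>"


section \<open>Double functors\<close>

record ('o, 'h, 'v, 's, 'o2, 'h2, 'v2, 's2) dblfun =
  fobj :: "'o \<Rightarrow> 'o2"
  fhor :: "'h \<Rightarrow> 'h2"
  fver :: "'v \<Rightarrow> 'v2"
  fsq :: "'s \<Rightarrow> 's2"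

locale double_functor = D: double_category D + E: double_category E
  for D :: "('o, 'h, 'v, 's) dblcat" and E :: "('o2, 'h2, 'v2, 's2) dblcat" +
  fixes F :: "('o, 'h, 'v, 's, 'o2, 'h2, 'v2, 's2) dblfun"
  assumes fobj_closed: "C \<in> Obj D \<Longrightarrow> fobj F C \<in> Obj E"
    and fhor_closed: "f \<in> Hor D \<Longrightarrow> fhor F f \<in> Hor E"
    and fver_closed: "j \<in> Ver D \<Longrightarrow> fver F j \<in> Ver E"
    and fsq_closed: "\<alpha> \<in> Sq D \<Longrightarrow> fsq F \<alpha> \<in> Sq E"
    and hdom_fhor: "f \<in> Hor D \<Longrightarrow> hdom E (fhor F f) = fobj F (hdom D f)"
    and hcod_fhor: "f \<in> Hor D \<Longrightarrow> hcod E (fhor F f) = fobj F (hcod D f)"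
    and vdom_fver: "j \<in> Ver D \<Longrightarrow> vdom E (fver F j) = fobj F (vdom D j)"
    and vcod_fver: "j \<in> Ver D \<Longrightarrow> vcod E (fver F j) = fobj F (vcod D j)"
    and sleft_fsq: "\<alpha> \<in> Sq D \<Longrightarrow> sleft E (fsq F \<alpha>) = fver F (sleft D \<alpha>)"
    and sright_fsq: "\<alpha> \<in> Sq D \<Longrightarrow> sright E (fsq F \<alpha>) = fver F (sright D \<alpha>)"
    and stop_fsq: "\<alpha> \<in> Sq D \<Longrightarrow> stop E (fsq F \<alpha>) = fhor F (stop D \<alpha>)"
    and sbot_fsq: "\<alpha> \<in> Sq D \<Longrightarrow> sbot E (fsq F \<alpha>) = fhor F (sbot D \<alpha>)"
    and fhor_hid: "C \<in> Obj D \<Longrightarrow> fhor F (hid D C) = hid E (fobj F C)"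
    and fver_vid: "C \<in> Obj D \<Longrightarrow> fver F (vid D C) = vid E (fobj F C)"
    and fsq_sqhid: "j \<in> Ver D \<Longrightarrow> fsq F (sqhid D j) = sqhid E (fver F j)"
    and fsq_sqvid: "f \<in> Hor D \<Longrightarrow> fsq F (sqvid D f) = sqvid E (fhor F f)"
    and fhor_hcomp: "\<lbrakk>f \<in> Hor D; g \<in> Hor D; hcod D f = hdom D g\<rbrakk>
      \<Longrightarrow> fhor F (hcomp D f g) = hcomp E (fhor F f) (fhor F g)"
    and fver_vcomp: "\<lbrakk>j \<in> Ver D; k \<in> Ver D; vcod D j = vdom D k\<rbrakk>
      \<Longrightarrow> fver F (vcomp D j k) = vcomp E (fver F j) (fver F k)"
    and fsq_sqh: "\<lbrakk>\<alpha> \<in> Sq D; \<beta> \<in> Sq D; sright D \<alpha> = sleft D \<beta>\<rbrakk>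
      \<Longrightarrow> fsq F (sqh D \<alpha> \<beta>) = sqh E (fsq F \<alpha>) (fsq F \<beta>)"
    and fsq_sqv: "\<lbrakk>\<alpha> \<in> Sq D; \<beta> \<in> Sq D; sbot D \<alpha> = stop D \<beta>\<rbrakk>
      \<Longrightarrow> fsq F (sqv D \<alpha> \<beta>) = sqv E (fsq F \<alpha>) (fsq F \<beta>)"

definition dfun_id :: "('o, 'h, 'v, 's, 'o, 'h, 'v, 's) dblfun" where
  "dfun_id = \<lparr>fobj = id, fhor = id, fver = id, fsq = id\<rparr>"

definition dfun_comp ::
  "('o2, 'h2, 'v2, 's2, 'o3, 'h3, 'v3, 's3) dblfun \<Rightarrow> ('o, 'h, 'v, 's, 'o2, 'h2, 'v2, 's2) dblfun
    \<Rightarrow> ('o, 'h, 'v, 's, 'o3, 'h3, 'v3, 's3) dblfun" (infixl \<open>\<circ>\<^sub>d\<close> 55) where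
  "G \<circ>\<^sub>d F = \<lparr>fobj = fobj G \<circ> fobj F, fhor = fhor G \<circ> fhor F,
     fver = fver G \<circ> fver F, fsq = fsq G \<circ> fsq F\<rparr>"


section \<open>Horizontal natural transformations and horizontal double adjunctions\<close>

record ('o, 'v, 'h2, 's2) htrans =
  tobj :: "'o \<Rightarrow> 'h2"
  tver :: "'v \<Rightarrow> 's2"

locale horizontal_transformation = F: double_functor D E F + G: double_functor D E G
  for D :: "('o, 'h, 'v, 's) dblcat" and E :: "('o2, 'h2, 'v2, 's2) dblcat"
    and F G :: "('o, 'h, 'v, 's, 'o2, 'h2, 'v2, 's2) dblfun" +
  fixes \<theta> :: "('o, 'v, 'h2, 's2) htrans"
  assumes tobj_closed: "C \<in> Obj D \<Longrightarrow> tobj \<theta> C \<in> Hor E"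
    and hdom_tobj: "C \<in> Obj D \<Longrightarrow> hdom E (tobj \<theta> C) = fobj F C"
    and hcod_tobj: "C \<in> Obj D \<Longrightarrow> hcod E (tobj \<theta> C) = fobj G C"
    and tver_closed: "j \<in> Ver D \<Longrightarrow> tver \<theta> j \<in> Sq E"
    and sleft_tver: "j \<in> Ver D \<Longrightarrow> sleft E (tver \<theta> j) = fver F j"
    and sright_tver: "j \<in> Ver D \<Longrightarrow> sright E (tver \<theta> j) = fver G j"
    and stop_tver: "j \<in> Ver D \<Longrightarrow> stop E (tver \<theta> j) = tobj \<theta> (vdom D j)"
    and sbot_tver: "j \<in> Ver D \<Longrightarrow> sbot E (tver \<theta> j) = tobj \<theta> (vcod D j)"
    and tver_vid: "C \<in> Obj D \<Longrightarrow> tver \<theta> (vid D C) = sqvid E (tobj \<theta> C)"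
    and tver_vcomp: "\<lbrakk>j \<in> Ver D; k \<in> Ver D; vcod D j = vdom D k\<rbrakk>
      \<Longrightarrow> tver \<theta> (vcomp D j k) = sqv E (tver \<theta> j) (tver \<theta> k)"
    and naturality: "\<alpha> \<in> Sq D
      \<Longrightarrow> sqh E (fsq F \<alpha>) (tver \<theta> (sright D \<alpha>)) = sqh E (tver \<theta> (sleft D \<alpha>)) (fsq G \<alpha>)"

definition htrans_id ::
  "('o2, 'h2, 'v2, 's2) dblcat \<Rightarrow> ('o, 'h, 'v, 's, 'o2, 'h2, 'v2, 's2) dblfun
    \<Rightarrow> ('o, 'v, 'h2, 's2) htrans" where
  "htrans_id E F = \<lparr>tobj = (\<lambda>C. hid E (fobj F C)), tver = (\<lambda>j. sqhid E (fver F j))\<rparr>"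

definition htrans_comp ::
  "('o2, 'h2, 'v2, 's2) dblcat \<Rightarrow> ('o, 'v, 'h2, 's2) htrans \<Rightarrow> ('o, 'v, 'h2, 's2) htrans
    \<Rightarrow> ('o, 'v, 'h2, 's2) htrans" where
  "htrans_comp E \<theta> \<tau> = \<lparr>tobj = (\<lambda>C. hcomp E (tobj \<theta> C) (tobj \<tau> C)),
     tver = (\<lambda>j. sqh E (tver \<theta> j) (tver \<tau> j))\<rparr>"

text \<open>The whiskerings $H\theta$ and $\theta H$.\<close>

definition whisker_post ::
  "('o2, 'h2, 'v2, 's2, 'o3, 'h3, 'v3, 's3) dblfun \<Rightarrow> ('o, 'v, 'h2, 's2) htrans
    \<Rightarrow> ('o, 'v, 'h3, 's3) htrans" where
  "whisker_post H \<theta> = \<lparr>tobj = fhor H \<circ> tobj \<theta>, tver = fsq H \<circ> tver \<theta>\<rparr>"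

definition whisker_pre ::
  "('o2, 'v2, 'h3, 's3) htrans \<Rightarrow> ('o, 'h, 'v, 's, 'o2, 'h2, 'v2, 's2) dblfun
    \<Rightarrow> ('o, 'v, 'h3, 's3) htrans" where
  "whisker_pre \<theta> H = \<lparr>tobj = tobj \<theta> \<circ> fobj H, tver = tver \<theta> \<circ> fver H\<rparr>"

text \<open>Equality of transformations out of \<open>D\<close>: values outside the carriers of \<open>D\<close> are irrelevant.\<close>

definition htrans_eq ::
  "('o, 'h, 'v, 's) dblcat \<Rightarrow> ('o, 'v, 'h2, 's2) htrans \<Rightarrow> ('o, 'v, 'h2, 's2) htrans \<Rightarrow> bool" where
  "htrans_eq D \<theta> \<tau> \<longleftrightarrow>
     (\<forall>C\<in>Obj D. tobj \<theta> C = tobj \<tau> C) \<and> (\<forall>j\<in>Ver D. tver \<theta> j = tver \<tau> j)"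

locale horizontal_double_adjunction =
  F: double_functor X A F + G: double_functor A X G +
  unit: horizontal_transformation X X dfun_id "G \<circ>\<^sub>d F" \<eta> +
  counit: horizontal_transformation A A "F \<circ>\<^sub>d G" dfun_id \<epsilon>
  for X :: "('ox, 'hx, 'vx, 'sx) dblcat" and A :: "('oa, 'ha, 'va, 'sa) dblcat"
    and F :: "('ox, 'hx, 'vx, 'sx, 'oa, 'ha, 'va, 'sa) dblfun"
    and G :: "('oa, 'ha, 'va, 'sa, 'ox, 'hx, 'vx, 'sx) dblfun"
    and \<eta> :: "('ox, 'vx, 'hx, 'sx) htrans" and \<epsilon> :: "('oa, 'va, 'ha, 'sa) htrans" +
  assumes triangle_left:
      "htrans_eq X (htrans_comp A (whisker_post F \<eta>) (whisker_pre \<epsilon> F)) (htrans_id A F)"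
    and triangle_right:
      "htrans_eq A (htrans_comp X (whisker_pre \<eta> G) (whisker_post G \<epsilon>)) (htrans_id X G)"

definition has_horizontal_right_double_adjoint ::
  "('ox, 'hx, 'vx, 'sx) dblcat \<Rightarrow> ('oa, 'ha, 'va, 'sa) dblcat
    \<Rightarrow> ('ox, 'hx, 'vx, 'sx, 'oa, 'ha, 'va, 'sa) dblfun \<Rightarrow> bool" where
  "has_horizontal_right_double_adjoint X A F \<longleftrightarrow>
     (\<exists>G \<eta> \<epsilon>. horizontal_double_adjunction X A F G \<eta> \<epsilon>)"


section \<open>Parameterized presheaves\<close>

text \<open>
  A vertically lax double functor \<open>K\<close> from \<open>D\<close> to the weak double category
  $\mathbb{S}\mathrm{pan}^t$ of sets, functions and spans, given by its explicit data.
  The sets \<open>kobj K C\<close> and the apices \<open>kver K j\<close> of the spans are subsets of ambient types, and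
  \<open>ktop K j\<close>, \<open>kbot K j\<close> are the two legs of the span \<open>kver K j\<close>. An element of the pullback
  $K(j)\times_{K(C')}K(k)$ is a pair \<open>p \<in> kver K j\<close>, \<open>q \<in> kver K k\<close> with
  \<open>kbot K j p = ktop K k q\<close>; the comparison map sends it to \<open>kcomp K j k p q\<close>. The comparison
  map at an object is \<open>kunit K C\<close>. As \<open>K\<close> is covariant in \<open>D\<close>, contravariance in \<open>X\<close> comes from
  taking \<open>D = horop X \<times>\<^sub>d E\<close>.
\<close>

record ('o, 'h, 'v, 's, 'p, 'q) spanfun =
  kobj :: "'o \<Rightarrow> 'p set"
  khor :: "'h \<Rightarrow> 'p \<Rightarrow> 'p"
  kver :: "'v \<Rightarrow> 'q set"
  ktop :: "'v \<Rightarrow> 'q \<Rightarrow> 'p"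
  kbot :: "'v \<Rightarrow> 'q \<Rightarrow> 'p"
  ksq :: "'s \<Rightarrow> 'q \<Rightarrow> 'q"
  kcomp :: "'v \<Rightarrow> 'v \<Rightarrow> 'q \<Rightarrow> 'q \<Rightarrow> 'q"
  kunit :: "'o \<Rightarrow> 'p \<Rightarrow> 'q"

locale lax_span_functor = D: double_category D
  for D :: "('o, 'h, 'v, 's) dblcat" +
  fixes K :: "('o, 'h, 'v, 's, 'p, 'q) spanfun"
  assumes khor_closed: "\<lbrakk>f \<in> Hor D; x \<in> kobj K (hdom D f)\<rbrakk> \<Longrightarrow> khor K f x \<in> kobj K (hcod D f)"
    and ktop_closed: "\<lbrakk>j \<in> Ver D; p \<in> kver K j\<rbrakk> \<Longrightarrow> ktop K j p \<in> kobj K (vdom D j)"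
    and kbot_closed: "\<lbrakk>j \<in> Ver D; p \<in> kver K j\<rbrakk> \<Longrightarrow> kbot K j p \<in> kobj K (vcod D j)"
    and ksq_closed: "\<lbrakk>\<alpha> \<in> Sq D; p \<in> kver K (sleft D \<alpha>)\<rbrakk> \<Longrightarrow> ksq K \<alpha> p \<in> kver K (sright D \<alpha>)"
    and ktop_ksq: "\<lbrakk>\<alpha> \<in> Sq D; p \<in> kver K (sleft D \<alpha>)\<rbrakk>
      \<Longrightarrow> ktop K (sright D \<alpha>) (ksq K \<alpha> p) = khor K (stop D \<alpha>) (ktop K (sleft D \<alpha>) p)"
    and kbot_ksq: "\<lbrakk>\<alpha> \<in> Sq D; p \<in> kver K (sleft D \<alpha>)\<rbrakk>
      \<Longrightarrow> kbot K (sright D \<alpha>) (ksq K \<alpha> p) = khor K (sbot D \<alpha>) (kbot K (sleft D \<alpha>) p)"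
    and khor_hid: "\<lbrakk>C \<in> Obj D; x \<in> kobj K C\<rbrakk> \<Longrightarrow> khor K (hid D C) x = x"
    and khor_hcomp: "\<lbrakk>f \<in> Hor D; g \<in> Hor D; hcod D f = hdom D g; x \<in> kobj K (hdom D f)\<rbrakk>
      \<Longrightarrow> khor K (hcomp D f g) x = khor K g (khor K f x)"
    and ksq_sqhid: "\<lbrakk>j \<in> Ver D; p \<in> kver K j\<rbrakk> \<Longrightarrow> ksq K (sqhid D j) p = p"
    and ksq_sqh: "\<lbrakk>\<alpha> \<in> Sq D; \<beta> \<in> Sq D; sright D \<alpha> = sleft D \<beta>; p \<in> kver K (sleft D \<alpha>)\<rbrakk>
      \<Longrightarrow> ksq K (sqh D \<alpha> \<beta>) p = ksq K \<beta> (ksq K \<alpha> p)"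
    and kcomp_closed: "\<lbrakk>j \<in> Ver D; k \<in> Ver D; vcod D j = vdom D k;
        p \<in> kver K j; q \<in> kver K k; kbot K j p = ktop K k q\<rbrakk>
      \<Longrightarrow> kcomp K j k p q \<in> kver K (vcomp D j k)"
    and ktop_kcomp: "\<lbrakk>j \<in> Ver D; k \<in> Ver D; vcod D j = vdom D k;
        p \<in> kver K j; q \<in> kver K k; kbot K j p = ktop K k q\<rbrakk>
      \<Longrightarrow> ktop K (vcomp D j k) (kcomp K j k p q) = ktop K j p"
    and kbot_kcomp: "\<lbrakk>j \<in> Ver D; k \<in> Ver D; vcod D j = vdom D k;
        p \<in> kver K j; q \<in> kver K k; kbot K j p = ktop K k q\<rbrakk>
      \<Longrightarrow> kbot K (vcomp D j k) (kcomp K j k p q) = kbot K k q"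
    and kunit_closed: "\<lbrakk>C \<in> Obj D; x \<in> kobj K C\<rbrakk> \<Longrightarrow> kunit K C x \<in> kver K (vid D C)"
    and ktop_kunit: "\<lbrakk>C \<in> Obj D; x \<in> kobj K C\<rbrakk> \<Longrightarrow> ktop K (vid D C) (kunit K C x) = x"
    and kbot_kunit: "\<lbrakk>C \<in> Obj D; x \<in> kobj K C\<rbrakk> \<Longrightarrow> kbot K (vid D C) (kunit K C x) = x"
    and kcomp_natural: "\<lbrakk>\<alpha> \<in> Sq D; \<beta> \<in> Sq D; sbot D \<alpha> = stop D \<beta>;
        p \<in> kver K (sleft D \<alpha>); q \<in> kver K (sleft D \<beta>);
        kbot K (sleft D \<alpha>) p = ktop K (sleft D \<beta>) q\<rbrakk>
      \<Longrightarrow> ksq K (sqv D \<alpha> \<beta>) (kcomp K (sleft D \<alpha>) (sleft D \<beta>) p q)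
        = kcomp K (sright D \<alpha>) (sright D \<beta>) (ksq K \<alpha> p) (ksq K \<beta> q)"
    and kunit_natural: "\<lbrakk>f \<in> Hor D; x \<in> kobj K (hdom D f)\<rbrakk>
      \<Longrightarrow> ksq K (sqvid D f) (kunit K (hdom D f) x) = kunit K (hcod D f) (khor K f x)"
    and kcomp_assoc: "\<lbrakk>j \<in> Ver D; k \<in> Ver D; l \<in> Ver D; vcod D j = vdom D k; vcod D k = vdom D l;
        p \<in> kver K j; q \<in> kver K k; r \<in> kver K l;
        kbot K j p = ktop K k q; kbot K k q = ktop K l r\<rbrakk>
      \<Longrightarrow> kcomp K (vcomp D j k) l (kcomp K j k p q) r
        = kcomp K j (vcomp D k l) p (kcomp K k l q r)"
    and kcomp_unit_left: "\<lbrakk>j \<in> Ver D; p \<in> kver K j\<rbrakk>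
      \<Longrightarrow> kcomp K (vid D (vdom D j)) j (kunit K (vdom D j) (ktop K j p)) p = p"
    and kcomp_unit_right: "\<lbrakk>j \<in> Ver D; p \<in> kver K j\<rbrakk>
      \<Longrightarrow> kcomp K j (vid D (vcod D j)) p (kunit K (vcod D j) (kbot K j p)) = p"

record ('o, 'v, 'p, 'q, 'p2, 'q2) spantrans =
  mobj :: "'o \<Rightarrow> 'p \<Rightarrow> 'p2"
  mver :: "'v \<Rightarrow> 'q \<Rightarrow> 'q2"

locale lax_span_transformation = K: lax_span_functor D K + L: lax_span_functor D L
  for D :: "('o, 'h, 'v, 's) dblcat"
    and K :: "('o, 'h, 'v, 's, 'p, 'q) spanfun"
    and L :: "('o, 'h, 'v, 's, 'p2, 'q2) spanfun" +
  fixes \<phi> :: "('o, 'v, 'p, 'q, 'p2, 'q2) spantrans"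
  assumes mobj_closed: "\<lbrakk>C \<in> Obj D; x \<in> kobj K C\<rbrakk> \<Longrightarrow> mobj \<phi> C x \<in> kobj L C"
    and mver_closed: "\<lbrakk>j \<in> Ver D; p \<in> kver K j\<rbrakk> \<Longrightarrow> mver \<phi> j p \<in> kver L j"
    and ktop_mver: "\<lbrakk>j \<in> Ver D; p \<in> kver K j\<rbrakk>
      \<Longrightarrow> ktop L j (mver \<phi> j p) = mobj \<phi> (vdom D j) (ktop K j p)"
    and kbot_mver: "\<lbrakk>j \<in> Ver D; p \<in> kver K j\<rbrakk>
      \<Longrightarrow> kbot L j (mver \<phi> j p) = mobj \<phi> (vcod D j) (kbot K j p)"
    and mobj_natural: "\<lbrakk>f \<in> Hor D; x \<in> kobj K (hdom D f)\<rbrakk>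
      \<Longrightarrow> mobj \<phi> (hcod D f) (khor K f x) = khor L f (mobj \<phi> (hdom D f) x)"
    and mver_natural: "\<lbrakk>\<alpha> \<in> Sq D; p \<in> kver K (sleft D \<alpha>)\<rbrakk>
      \<Longrightarrow> mver \<phi> (sright D \<alpha>) (ksq K \<alpha> p) = ksq L \<alpha> (mver \<phi> (sleft D \<alpha>) p)"
    and mver_kcomp: "\<lbrakk>j \<in> Ver D; k \<in> Ver D; vcod D j = vdom D k;
        p \<in> kver K j; q \<in> kver K k; kbot K j p = ktop K k q\<rbrakk>
      \<Longrightarrow> mver \<phi> (vcomp D j k) (kcomp K j k p q) = kcomp L j k (mver \<phi> j p) (mver \<phi> k q)"
    and mver_kunit: "\<lbrakk>C \<in> Obj D; x \<in> kobj K C\<rbrakk>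
      \<Longrightarrow> mver \<phi> (vid D C) (kunit K C x) = kunit L C (mobj \<phi> C x)"

definition spantrans_id :: "('o, 'v, 'p, 'q, 'p, 'q) spantrans" where
  "spantrans_id = \<lparr>mobj = (\<lambda>C x. x), mver = (\<lambda>j p. p)\<rparr>"

text \<open>\<open>spantrans_comp \<phi> \<psi>\<close> is \<open>\<phi>\<close> followed by \<open>\<psi>\<close>.\<close>

definition spantrans_comp ::
  "('o, 'v, 'p, 'q, 'p2, 'q2) spantrans \<Rightarrow> ('o, 'v, 'p2, 'q2, 'p3, 'q3) spantrans
    \<Rightarrow> ('o, 'v, 'p, 'q, 'p3, 'q3) spantrans" where
  "spantrans_comp \<phi> \<psi> =
     \<lparr>mobj = (\<lambda>C. mobj \<psi> C \<circ> mobj \<phi> C), mver = (\<lambda>j. mver \<psi> j \<circ> mver \<phi> j)\<rparr>"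

text \<open>Equality of transformations out of \<open>K\<close>, again disregarding values outside the carriers.\<close>

definition spantrans_eq ::
  "('o, 'h, 'v, 's) dblcat \<Rightarrow> ('o, 'h, 'v, 's, 'p, 'q) spanfun
    \<Rightarrow> ('o, 'v, 'p, 'q, 'p2, 'q2) spantrans \<Rightarrow> ('o, 'v, 'p, 'q, 'p2, 'q2) spantrans \<Rightarrow> bool" where
  "spantrans_eq D K \<phi> \<psi> \<longleftrightarrow>
     (\<forall>C\<in>Obj D. \<forall>x\<in>kobj K C. mobj \<phi> C x = mobj \<psi> C x) \<and>
     (\<forall>j\<in>Ver D. \<forall>p\<in>kver K j. mver \<phi> j p = mver \<psi> j p)"

abbreviation parameterized_presheaf ::
  "('ox, 'hx, 'vx, 'sx) dblcat \<Rightarrow> ('oe, 'he, 've, 'se) dblcat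
    \<Rightarrow> ('ox \<times> 'oe, 'hx \<times> 'he, 'vx \<times> 've, 'sx \<times> 'se, 'p, 'q) spanfun \<Rightarrow> bool" where
  "parameterized_presheaf X E K \<equiv> lax_span_functor (horop X \<times>\<^sub>d E) K"

abbreviation presheaf_morphism ::
  "('ox, 'hx, 'vx, 'sx) dblcat \<Rightarrow> ('oe, 'he, 've, 'se) dblcat
    \<Rightarrow> ('ox \<times> 'oe, 'hx \<times> 'he, 'vx \<times> 've, 'sx \<times> 'se, 'p, 'q) spanfun
    \<Rightarrow> ('ox \<times> 'oe, 'hx \<times> 'he, 'vx \<times> 've, 'sx \<times> 'se, 'p2, 'q2) spanfun
    \<Rightarrow> ('ox \<times> 'oe, 'vx \<times> 've, 'p, 'q, 'p2, 'q2) spantrans \<Rightarrow> bool" where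
  "presheaf_morphism X E K L \<phi> \<equiv> lax_span_transformation (horop X \<times>\<^sub>d E) K L \<phi>"

definition presheaf_isomorphic ::
  "('ox, 'hx, 'vx, 'sx) dblcat \<Rightarrow> ('oe, 'he, 've, 'se) dblcat
    \<Rightarrow> ('ox \<times> 'oe, 'hx \<times> 'he, 'vx \<times> 've, 'sx \<times> 'se, 'p, 'q) spanfun
    \<Rightarrow> ('ox \<times> 'oe, 'hx \<times> 'he, 'vx \<times> 've, 'sx \<times> 'se, 'p2, 'q2) spanfun \<Rightarrow> bool" where
  "presheaf_isomorphic X E K L \<longleftrightarrow>
     (\<exists>\<phi> \<psi>. presheaf_morphism X E K L \<phi> \<and> presheaf_morphism X E L K \<psi> \<and>
        spantrans_eq (horop X \<times>\<^sub>d E) K (spantrans_comp \<phi> \<psi>) spantrans_id \<and>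
        spantrans_eq (horop X \<times>\<^sub>d E) L (spantrans_comp \<psi> \<phi>) spantrans_id)"


section \<open>Representable parameterized presheaves\<close>

text \<open>
  The presheaf $\mathbb{A}(F-,H-)$ on \<open>X\<close> parameterized by \<open>E\<close>, for double functors \<open>F\<close> from \<open>X\<close> to
  \<open>A\<close> and \<open>H\<close> from \<open>E\<close> to \<open>A\<close>. A horizontal morphism of \<open>horop X \<times>\<^sub>d E\<close> from \<open>(C, B)\<close> to
  \<open>(C', B')\<close> is a pair of \<open>f\<close> from \<open>C'\<close> to \<open>C\<close> in \<open>X\<close> and \<open>e\<close> from \<open>B\<close> to \<open>B'\<close> in \<open>E\<close>; it sends
  \<open>x\<close> to $[Ff\ x\ He]$, and similarly for squares.
\<close>

definition hom_presheaf ::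
  "('oa, 'ha, 'va, 'sa) dblcat \<Rightarrow> ('ox, 'hx, 'vx, 'sx, 'oa, 'ha, 'va, 'sa) dblfun
    \<Rightarrow> ('oe, 'he, 've, 'se, 'oa, 'ha, 'va, 'sa) dblfun
    \<Rightarrow> ('ox \<times> 'oe, 'hx \<times> 'he, 'vx \<times> 've, 'sx \<times> 'se, 'ha, 'sa) spanfun" where
  "hom_presheaf A F H = \<lparr>
     kobj = (\<lambda>(C, B). {x \<in> Hor A. hdom A x = fobj F C \<and> hcod A x = fobj H B}),
     khor = (\<lambda>(f, e) x. hcomp A (hcomp A (fhor F f) x) (fhor H e)),
     kver = (\<lambda>(j, k). {\<xi> \<in> Sq A. sleft A \<xi> = fver F j \<and> sright A \<xi> = fver H k}),
     ktop = (\<lambda>_. stop A),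
     kbot = (\<lambda>_. sbot A),
     ksq = (\<lambda>(\<alpha>, \<epsilon>) \<xi>. sqh A (sqh A (fsq F \<alpha>) \<xi>) (fsq H \<epsilon>)),
     kcomp = (\<lambda>_ _. sqv A),
     kunit = (\<lambda>_. sqvid A)\<rparr>"

text \<open>
  $\mathbb{A}(F-,-)$ on $\mathbb{X}^{\mathrm{horop}}\times\mathbb{V}_1\mathbb{A}$: the second variable
  enters through the inclusion of \<open>V1 A\<close> into \<open>A\<close>, which is the identity on all data.
  Symmetrically, \<open>right_hom_presheaf X G0\<close> is $\mathbb{X}(-,G_0-)$.
\<close>

abbreviation left_hom_presheaf ::
  "('oa, 'ha, 'va, 'sa) dblcat \<Rightarrow> ('ox, 'hx, 'vx, 'sx, 'oa, 'ha, 'va, 'sa) dblfun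
    \<Rightarrow> ('ox \<times> 'oa, 'hx \<times> 'ha, 'vx \<times> 'va, 'sx \<times> 'sa, 'ha, 'sa) spanfun" where
  "left_hom_presheaf A F \<equiv> hom_presheaf A F dfun_id"

abbreviation right_hom_presheaf ::
  "('ox, 'hx, 'vx, 'sx) dblcat \<Rightarrow> ('oe, 'he, 've, 'se, 'ox, 'hx, 'vx, 'sx) dblfun
    \<Rightarrow> ('ox \<times> 'oe, 'hx \<times> 'he, 'vx \<times> 've, 'sx \<times> 'se, 'hx, 'sx) spanfun" where
  "right_hom_presheaf X G0 \<equiv> hom_presheaf X dfun_id G0"

definition represented_by ::
  "('ox, 'hx, 'vx, 'sx) dblcat \<Rightarrow> ('oe, 'he, 've, 'se) dblcat
    \<Rightarrow> ('ox \<times> 'oe, 'hx \<times> 'he, 'vx \<times> 've, 'sx \<times> 'se, 'p, 'q) spanfun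
    \<Rightarrow> ('oe, 'he, 've, 'se, 'ox, 'hx, 'vx, 'sx) dblfun \<Rightarrow> bool" where
  "represented_by X E K G0 \<longleftrightarrow>
     double_functor E X G0 \<and> presheaf_isomorphic X E K (right_hom_presheaf X G0)"

end

theory Submission
  imports Defs
begin

text \<open>
  A double category is a pair of categories, one of objects and horizontal morphisms and one of
  vertical morphisms and squares, tied together by the vertical structure. A horizontal double
  adjunction is an adjunction between the former and one between the latter, both compatible with
  tops, bottoms, vertical composition and vertical identities; an isomorphism of the two presheaves
  is a pair of natural bijections of hom sets subject to the same compatibilities. So the classical
  correspondence applies twice. In one direction \<open>\<phi> x = [\<eta> Gx]\<close>; in the other
  \<open>\<epsilon>\<close> and \<open>\<eta>\<close> are the transposes of identities and \<open>G\<close> is extended from \<open>V1 A\<close> to all of \<open>A\<close> by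
  \<open>G h = \<phi> [\<epsilon> h]\<close>. The extension preserves vertical composition by interchange, because
  \<open>\<phi>\<close> and \<open>\<epsilon>\<close> do.
\<close>

section \<open>Ordinary adjunctions\<close>

locale category_functor =
  C: small_category ObC ArC srcC tgtC ideC compC +
  D: small_category ObD ArD srcD tgtD ideD compD
  for ObC :: "'o set" and ArC :: "'m set" and srcC tgtC ideC compC
    and ObD :: "'p set" and ArD :: "'n set" and srcD tgtD ideD compD +
  fixes Fo :: "'o \<Rightarrow> 'p" and Fa :: "'m \<Rightarrow> 'n"
  assumes Fo_closed: "c \<in> ObC \<Longrightarrow> Fo c \<in> ObD"
    and Fa_closed: "f \<in> ArC \<Longrightarrow> Fa f \<in> ArD"
    and src_Fa: "f \<in> ArC \<Longrightarrow> srcD (Fa f) = Fo (srcC f)"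
    and tgt_Fa: "f \<in> ArC \<Longrightarrow> tgtD (Fa f) = Fo (tgtC f)"
    and Fa_ide: "c \<in> ObC \<Longrightarrow> Fa (ideC c) = ideD (Fo c)"
    and Fa_comp: "\<lbrakk>f \<in> ArC; g \<in> ArC; tgtC f = srcC g\<rbrakk> \<Longrightarrow> Fa (compC f g) = compD (Fa f) (Fa g)"

lemmas (in small_category) small_category_simps =
  src_closed tgt_closed ide_closed src_ide tgt_ide comp_closed src_comp tgt_comp
  comp_ide_left comp_ide_right

lemmas (in category_functor) category_functor_simps =
  Fo_closed Fa_closed src_Fa tgt_Fa Fa_ide Fa_comp

section \<open>Adjunctions from bijections of hom sets natural in one variable\<close>

locale category_representation =
  category_functor ObC ArC srcC tgtC ideC compC ObD ArD srcD tgtD ideD compD Fo Fa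
  for ObC :: "'o set" and ArC :: "'m set" and srcC tgtC ideC compC
    and ObD :: "'p set" and ArD :: "'n set" and srcD tgtD ideD compD Fo Fa +
  fixes Go :: "'p \<Rightarrow> 'o" and \<phi> :: "'o \<Rightarrow> 'p \<Rightarrow> 'n \<Rightarrow> 'm" and \<psi> :: "'o \<Rightarrow> 'p \<Rightarrow> 'm \<Rightarrow> 'n"
  assumes Go_closed: "b \<in> ObD \<Longrightarrow> Go b \<in> ObC"
    and \<phi>_hom: "\<lbrakk>c \<in> ObC; b \<in> ObD; x \<in> ArD; srcD x = Fo c; tgtD x = b\<rbrakk>
      \<Longrightarrow> \<phi> c b x \<in> ArC \<and> srcC (\<phi> c b x) = c \<and> tgtC (\<phi> c b x) = Go b"
    and \<psi>_hom: "\<lbrakk>c \<in> ObC; b \<in> ObD; y \<in> ArC; srcC y = c; tgtC y = Go b\<rbrakk>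
      \<Longrightarrow> \<psi> c b y \<in> ArD \<and> srcD (\<psi> c b y) = Fo c \<and> tgtD (\<psi> c b y) = b"
    and \<psi>_\<phi>: "\<lbrakk>c \<in> ObC; b \<in> ObD; x \<in> ArD; srcD x = Fo c; tgtD x = b\<rbrakk> \<Longrightarrow> \<psi> c b (\<phi> c b x) = x"
    and \<phi>_\<psi>: "\<lbrakk>c \<in> ObC; b \<in> ObD; y \<in> ArC; srcC y = c; tgtC y = Go b\<rbrakk> \<Longrightarrow> \<phi> c b (\<psi> c b y) = y"
    and \<phi>_natural: "\<lbrakk>u \<in> ArC; b \<in> ObD; x \<in> ArD; srcD x = Fo (tgtC u); tgtD x = b\<rbrakk>
      \<Longrightarrow> \<phi> (srcC u) b (compD (Fa u) x) = compC u (\<phi> (tgtC u) b x)"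
    and \<psi>_natural: "\<lbrakk>u \<in> ArC; b \<in> ObD; y \<in> ArC; srcC y = tgtC u; tgtC y = Go b\<rbrakk>
      \<Longrightarrow> \<psi> (srcC u) b (compC u y) = compD (Fa u) (\<psi> (tgtC u) b y)"
begin

definition counit :: "'p \<Rightarrow> 'n" where "counit b = \<psi> (Go b) b (ideC (Go b))"

definition unit :: "'o \<Rightarrow> 'm" where "unit c = \<phi> c (Fo c) (ideD (Fo c))"

text \<open>So far \<open>Go\<close> acts on objects only and \<open>\<phi>\<close> is natural in
  \<open>c\<close> alone. The action on arrows is forced: by \<open>\<psi>_eq\<close> below, this is
  the only arrow from \<open>Go (srcD h)\<close> to \<open>Go (tgtD h)\<close> for which the counit
  is natural at \<open>h\<close>.\<close>

definition Ga :: "'n \<Rightarrow> 'm" where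
  "Ga h = \<phi> (Go (srcD h)) (tgtD h) (compD (counit (srcD h)) h)"

lemma counit_hom:
  assumes "b \<in> ObD"
  shows "counit b \<in> ArD" "srcD (counit b) = Fo (Go b)" "tgtD (counit b) = b"
  using \<psi>_hom[of "Go b" b "ideC (Go b)"] assms
  by (auto simp: counit_def Go_closed C.small_category_simps)

lemma unit_hom:
  assumes "c \<in> ObC"
  shows "unit c \<in> ArC" "srcC (unit c) = c" "tgtC (unit c) = Go (Fo c)"
  using \<phi>_hom[of c "Fo c" "ideD (Fo c)"] assms
  by (auto simp: unit_def Fo_closed D.small_category_simps)

lemma Ga_hom:
  assumes "h \<in> ArD"
  shows "Ga h \<in> ArC" "srcC (Ga h) = Go (srcD h)" "tgtC (Ga h) = Go (tgtD h)"
  using \<phi>_hom[of "Go (srcD h)" "tgtD h" "compD (counit (srcD h)) h"] assms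
  by (auto simp: Ga_def Go_closed counit_hom D.small_category_simps)

text \<open>By the Yoneda lemma the transposes are determined by the counit.\<close>

lemma \<psi>_eq:
  assumes "b \<in> ObD" "y \<in> ArC" "srcC y = c" "tgtC y = Go b"
  shows "\<psi> c b y = compD (Fa y) (counit b)"
  using \<psi>_natural[of y b "ideC (Go b)"] C.comp_ide_right[of y] assms
  by (simp add: counit_def Go_closed C.small_category_simps)

lemma counit_natural:
  assumes "h \<in> ArD"
  shows "compD (Fa (Ga h)) (counit (tgtD h)) = compD (counit (srcD h)) h"
proof -
  have "compD (Fa (Ga h)) (counit (tgtD h)) = \<psi> (srcC (Ga h)) (tgtD h) (Ga h)"
    using assms by (simp add: \<psi>_eq Ga_hom D.small_category_simps)
  also have "\<dots> = compD (counit (srcD h)) h"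
    \<comment> \<open>The index \<open>srcC (Ga h)\<close> is rewritten before \<open>Ga\<close> is
      unfolded; it becomes \<open>Go (srcD h)\<close>, the index at which \<open>\<phi>\<close> was
      taken, so that \<open>\<psi>\<close> cancels \<open>\<phi>\<close>.\<close>
    unfolding Ga_hom(2)[OF assms] unfolding Ga_def
    using assms by (simp add: \<psi>_\<phi> Go_closed counit_hom D.small_category_simps)
  finally show ?thesis .
qed

text \<open>Naturality of \<open>\<phi>\<close> along \<open>y\<close> absorbs \<open>y\<close> into
  the transpose. Equations between composites ending in \<open>Ga h\<close> thereby reduce to
  equations in the target category, as in the functoriality of \<open>Ga\<close>, the naturality of
  the unit and the second triangle identity.\<close>

lemma comp_Ga:
  assumes "y \<in> ArC" "h \<in> ArD" "tgtC y = Go (srcD h)"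
  shows "compC y (Ga h) = \<phi> (srcC y) (tgtD h) (compD (compD (Fa y) (counit (srcD h))) h)"
  using \<phi>_natural[of y "tgtD h" "compD (counit (srcD h)) h"] assms
  by (simp add: Ga_def counit_hom category_functor_simps D.small_category_simps D.comp_assoc)

lemma \<phi>_counit: "b \<in> ObD \<Longrightarrow> \<phi> (Go b) b (counit b) = ideC (Go b)"
  by (simp add: counit_def \<phi>_\<psi> Go_closed C.small_category_simps)

text \<open>The left side is the transpose under \<open>\<psi>\<close> of the unit, which is itself
  the transpose of an identity.\<close>

lemma triangle_left:
  assumes "c \<in> ObC"
  shows "compD (Fa (unit c)) (counit (Fo c)) = ideD (Fo c)"
proof -
  have "compD (Fa (unit c)) (counit (Fo c)) = \<psi> (srcC (unit c)) (Fo c) (unit c)"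
    using assms by (simp add: \<psi>_eq unit_hom Fo_closed)
  also have "\<dots> = ideD (Fo c)"
    unfolding unit_hom(2)[OF assms] unfolding unit_def
    using assms by (simp add: \<psi>_\<phi> Fo_closed D.small_category_simps)
  finally show ?thesis .
qed

lemma Ga_ide: "b \<in> ObD \<Longrightarrow> Ga (ideD b) = ideC (Go b)"
  using D.comp_ide_right[of "counit b"]
  by (simp add: Ga_def counit_hom \<phi>_counit D.small_category_simps)

text \<open>By \<open>comp_Ga\<close> the right side is a transpose in which
  \<open>Fa (Ga h)\<close> is followed by the counit; naturality of the counit replaces these two by
  the counit followed by \<open>h\<close>.\<close>

lemma Ga_comp:
  assumes "h \<in> ArD" "h' \<in> ArD" "tgtD h = srcD h'"
  shows "Ga (compD h h') = compC (Ga h) (Ga h')"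
  using assms counit_natural[of h]
  by (simp add: comp_Ga Ga_hom)
    (simp add: Ga_def counit_hom D.small_category_simps D.comp_assoc)

text \<open>Both sides are the transpose of \<open>Fa u\<close>: the left one by naturality of
  \<open>\<phi>\<close>, the right one by \<open>comp_Ga\<close> and the first triangle
  identity.\<close>

lemma unit_natural:
  assumes "u \<in> ArC"
  shows "compC u (unit (tgtC u)) = compC (unit (srcC u)) (Ga (Fa u))"
proof -
  have "compC u (unit (tgtC u)) = \<phi> (srcC u) (Fo (tgtC u)) (compD (Fa u) (ideD (Fo (tgtC u))))"
    using assms by (simp add: unit_def \<phi>_natural category_functor_simps C.small_category_simps D.small_category_simps)
  also have "\<dots> = \<phi> (srcC u) (Fo (tgtC u)) (Fa u)"
    using assms D.comp_ide_right[of "Fa u"] by (simp add: category_functor_simps)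
  also have "\<dots> = compC (unit (srcC u)) (Ga (Fa u))"
    using assms D.comp_ide_left[of "Fa u"]
    by (simp add: comp_Ga unit_hom triangle_left category_functor_simps C.small_category_simps)
  finally show ?thesis .
qed

text \<open>After \<open>comp_Ga\<close> the first triangle identity leaves the transpose of the
  counit, which is an identity.\<close>

lemma triangle_right:
  assumes "b \<in> ObD"
  shows "compC (unit (Go b)) (Ga (counit b)) = ideC (Go b)"
  using assms D.comp_ide_left[of "counit b"]
  by (simp add: comp_Ga unit_hom counit_hom triangle_left Go_closed Fo_closed \<phi>_counit)

end

section \<open>Hom set bijections from an adjunction given by unit and counit\<close>

locale category_adjunction =
  F: category_functor ObC ArC srcC tgtC ideC compC ObD ArD srcD tgtD ideD compD Fo Fa +
  G: category_functor ObD ArD srcD tgtD ideD compD ObC ArC srcC tgtC ideC compC Go Ga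
  for ObC :: "'o set" and ArC :: "'m set" and srcC tgtC ideC compC
    and ObD :: "'p set" and ArD :: "'n set" and srcD tgtD ideD compD Fo Fa Go Ga +
  fixes \<eta> :: "'o \<Rightarrow> 'm" and \<epsilon> :: "'p \<Rightarrow> 'n"
  assumes unit_closed: "c \<in> ObC \<Longrightarrow> \<eta> c \<in> ArC"
    and src_unit: "c \<in> ObC \<Longrightarrow> srcC (\<eta> c) = c"
    and tgt_unit: "c \<in> ObC \<Longrightarrow> tgtC (\<eta> c) = Go (Fo c)"
    and counit_closed: "b \<in> ObD \<Longrightarrow> \<epsilon> b \<in> ArD"
    and src_counit: "b \<in> ObD \<Longrightarrow> srcD (\<epsilon> b) = Fo (Go b)"
    and tgt_counit: "b \<in> ObD \<Longrightarrow> tgtD (\<epsilon> b) = b"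
    and unit_natural: "f \<in> ArC \<Longrightarrow> compC f (\<eta> (tgtC f)) = compC (\<eta> (srcC f)) (Ga (Fa f))"
    and counit_natural: "g \<in> ArD \<Longrightarrow> compD (Fa (Ga g)) (\<epsilon> (tgtD g)) = compD (\<epsilon> (srcD g)) g"
    and triangle_left: "c \<in> ObC \<Longrightarrow> compD (Fa (\<eta> c)) (\<epsilon> (Fo c)) = ideD (Fo c)"
    and triangle_right: "b \<in> ObD \<Longrightarrow> compC (\<eta> (Go b)) (Ga (\<epsilon> b)) = ideC (Go b)"
begin

text \<open>The index supplies the object that the arrow leaves undetermined: the source of
  \<open>x\<close> is known only as \<open>Fo c\<close>. Dually, the target of \<open>y\<close> in
  \<open>\<psi> b y\<close> is known only as \<open>Go b\<close>.\<close>

definition \<phi> :: "'o \<Rightarrow> 'n \<Rightarrow> 'm" where "\<phi> c x = compC (\<eta> c) (Ga x)"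

definition \<psi> :: "'p \<Rightarrow> 'm \<Rightarrow> 'n" where "\<psi> b y = compD (Fa y) (\<epsilon> b)"

lemma \<phi>_hom:
  assumes "c \<in> ObC" "x \<in> ArD" "srcD x = Fo c"
  shows "\<phi> c x \<in> ArC" "srcC (\<phi> c x) = c" "tgtC (\<phi> c x) = Go (tgtD x)"
  using assms
  by (simp_all add: \<phi>_def unit_closed src_unit tgt_unit F.C.small_category_simps G.category_functor_simps)

lemma \<psi>_hom:
  assumes "b \<in> ObD" "y \<in> ArC" "tgtC y = Go b"
  shows "\<psi> b y \<in> ArD" "srcD (\<psi> b y) = Fo (srcC y)" "tgtD (\<psi> b y) = b"
  using assms
  by (simp_all add: \<psi>_def counit_closed src_counit tgt_counit F.D.small_category_simps F.category_functor_simps)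

text \<open>Naturality of the counit at \<open>x\<close> moves \<open>x\<close> to the end, and the
  first triangle identity removes what precedes it.\<close>

lemma \<psi>_\<phi>:
  assumes "c \<in> ObC" "x \<in> ArD" "srcD x = Fo c"
  shows "\<psi> (tgtD x) (\<phi> c x) = x"
proof -
  have "\<psi> (tgtD x) (\<phi> c x) = compD (Fa (\<eta> c)) (compD (Fa (Ga x)) (\<epsilon> (tgtD x)))"
    using assms
    by (simp add: \<psi>_def \<phi>_def unit_closed src_unit tgt_unit counit_closed src_counit tgt_counit
        F.D.small_category_simps F.category_functor_simps G.category_functor_simps F.D.comp_assoc)
  also have "\<dots> = compD (compD (Fa (\<eta> c)) (\<epsilon> (Fo c))) x"
    using assms
    by (simp add: counit_natural unit_closed tgt_unit counit_closed src_counit tgt_counit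
        F.category_functor_simps F.D.comp_assoc)
  finally show ?thesis using assms F.D.comp_ide_left[of x] by (simp add: triangle_left)
qed

text \<open>Dually, naturality of the unit at \<open>y\<close> moves \<open>y\<close> to the front,
  leaving the second triangle identity.\<close>

lemma \<phi>_\<psi>:
  assumes "b \<in> ObD" "y \<in> ArC" "tgtC y = Go b"
  shows "\<phi> (srcC y) (\<psi> b y) = y"
proof -
  have "\<phi> (srcC y) (\<psi> b y) = compC (compC (\<eta> (srcC y)) (Ga (Fa y))) (Ga (\<epsilon> b))"
    using assms
    by (simp add: \<psi>_def \<phi>_def unit_closed src_unit tgt_unit counit_closed src_counit tgt_counit
        F.C.small_category_simps F.category_functor_simps G.category_functor_simps F.C.comp_assoc)
  also have "\<dots> = compC y (compC (\<eta> (Go b)) (Ga (\<epsilon> b)))"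
    using assms unit_natural[of y, symmetric]
    by (simp add: unit_closed tgt_unit src_unit counit_closed src_counit tgt_counit
        F.category_functor_simps G.category_functor_simps F.C.comp_assoc)
  finally show ?thesis using assms F.C.comp_ide_right[of y] by (simp add: triangle_right)
qed

lemma \<phi>_natural:
  assumes "u \<in> ArC" "x \<in> ArD" "srcD x = Fo (tgtC u)"
  shows "\<phi> (srcC u) (compD (Fa u) x) = compC u (\<phi> (tgtC u) x)"
proof -
  have "\<phi> (srcC u) (compD (Fa u) x) = compC (compC (\<eta> (srcC u)) (Ga (Fa u))) (Ga x)"
    using assms
    by (simp add: \<phi>_def unit_closed src_unit tgt_unit
        F.C.small_category_simps F.category_functor_simps G.category_functor_simps F.C.comp_assoc)
  then show ?thesis
    using assms unit_natural[of u, symmetric]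
    by (simp add: \<phi>_def unit_closed src_unit tgt_unit
        F.C.small_category_simps G.category_functor_simps F.C.comp_assoc)
qed

lemma \<psi>_natural:
  assumes "u \<in> ArC" "b \<in> ObD" "y \<in> ArC" "tgtC u = srcC y" "tgtC y = Go b"
  shows "\<psi> b (compC u y) = compD (Fa u) (\<psi> b y)"
  using assms
  by (simp add: \<psi>_def counit_closed src_counit F.category_functor_simps F.D.comp_assoc)

end

section \<open>Products, duals and trivial parts of double categories\<close>

sublocale double_category \<subseteq>
  hor: small_category "Obj D" "Hor D" "hdom D" "hcod D" "hid D" "hcomp D"
  by (rule hor_category)

sublocale double_category \<subseteq>
  ver: small_category "Obj D" "Ver D" "vdom D" "vcod D" "vid D" "vcomp D"
  by (rule ver_category)

sublocale double_category \<subseteq>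
  sqh: small_category "Ver D" "Sq D" "sleft D" "sright D" "sqhid D" "sqh D"
  by (rule sqh_category)

sublocale double_category \<subseteq>
  sqv: small_category "Hor D" "Sq D" "stop D" "sbot D" "sqvid D" "sqv D"
  by (rule sqv_category)

context double_category
begin

lemmas boundary_simps =
  corner_top_left corner_top_right corner_bot_left corner_bot_right stop_sqhid sbot_sqhid
  stop_sqh sbot_sqh sleft_sqvid sright_sqvid sleft_sqv sright_sqv

lemmas double_category_simps =
  boundary_simps hor.small_category_simps ver.small_category_simps sqh.small_category_simps
  sqv.small_category_simps

end

section \<open>Opposites, products and wide subcategories, the ingredients of the double category
  constructions\<close>

lemma small_category_opposite:
  assumes "small_category Ob Ar src tgt ide cmp"
  shows "small_category Ob Ar tgt src ide (\<lambda>f g. cmp g f)"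
proof -
  interpret small_category Ob Ar src tgt ide cmp by fact
  show ?thesis
    by unfold_locales (simp_all add: small_category_simps comp_assoc)
qed

lemma small_category_product:
  assumes "small_category Ob Ar src tgt ide cmp"
    and "small_category Ob' Ar' src' tgt' ide' cmp'"
  shows "small_category (Ob \<times> Ob') (Ar \<times> Ar') (map_prod src src') (map_prod tgt tgt')
    (map_prod ide ide') (\<lambda>(f, f') (g, g'). (cmp f g, cmp' f' g'))"
proof -
  interpret C: small_category Ob Ar src tgt ide cmp by fact
  interpret D: small_category Ob' Ar' src' tgt' ide' cmp' by fact
  show ?thesis
    by unfold_locales
      (auto simp: C.small_category_simps D.small_category_simps C.comp_assoc D.comp_assoc)
qed

lemma small_category_subset:
  assumes "small_category Ob Ar src tgt ide cmp" and "Ar' \<subseteq> Ar"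
    and "\<And>a. a \<in> Ob \<Longrightarrow> ide a \<in> Ar'"
    and "\<And>f g. \<lbrakk>f \<in> Ar'; g \<in> Ar'; tgt f = src g\<rbrakk> \<Longrightarrow> cmp f g \<in> Ar'"
  shows "small_category Ob Ar' src tgt ide cmp"
proof -
  interpret small_category Ob Ar src tgt ide cmp by fact
  show ?thesis
    using assms(2-) by unfold_locales (auto simp: subset_iff small_category_simps comp_assoc)
qed

lemma horop_simps [simp]:
  "Obj (horop D) = Obj D" "Hor (horop D) = Hor D" "Ver (horop D) = Ver D" "Sq (horop D) = Sq D"
  "hdom (horop D) = hcod D" "hcod (horop D) = hdom D" "hid (horop D) = hid D"
  "hcomp (horop D) = (\<lambda>f g. hcomp D g f)"
  "vdom (horop D) = vdom D" "vcod (horop D) = vcod D" "vid (horop D) = vid D"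
  "vcomp (horop D) = vcomp D"
  "sleft (horop D) = sright D" "sright (horop D) = sleft D" "sqhid (horop D) = sqhid D"
  "sqh (horop D) = (\<lambda>\<alpha> \<beta>. sqh D \<beta> \<alpha>)"
  "stop (horop D) = stop D" "sbot (horop D) = sbot D" "sqvid (horop D) = sqvid D"
  "sqv (horop D) = sqv D"
  by (simp_all add: horop_def)

lemma dblprod_simps [simp]:
  "Obj (D \<times>\<^sub>d E) = Obj D \<times> Obj E" "Hor (D \<times>\<^sub>d E) = Hor D \<times> Hor E"
  "Ver (D \<times>\<^sub>d E) = Ver D \<times> Ver E" "Sq (D \<times>\<^sub>d E) = Sq D \<times> Sq E"
  "hdom (D \<times>\<^sub>d E) = map_prod (hdom D) (hdom E)" "hcod (D \<times>\<^sub>d E) = map_prod (hcod D) (hcod E)"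
  "hid (D \<times>\<^sub>d E) = map_prod (hid D) (hid E)"
  "hcomp (D \<times>\<^sub>d E) = (\<lambda>(f, f') (g, g'). (hcomp D f g, hcomp E f' g'))"
  "vdom (D \<times>\<^sub>d E) = map_prod (vdom D) (vdom E)" "vcod (D \<times>\<^sub>d E) = map_prod (vcod D) (vcod E)"
  "vid (D \<times>\<^sub>d E) = map_prod (vid D) (vid E)"
  "vcomp (D \<times>\<^sub>d E) = (\<lambda>(j, j') (k, k'). (vcomp D j k, vcomp E j' k'))"
  "sleft (D \<times>\<^sub>d E) = map_prod (sleft D) (sleft E)"
  "sright (D \<times>\<^sub>d E) = map_prod (sright D) (sright E)"
  "sqhid (D \<times>\<^sub>d E) = map_prod (sqhid D) (sqhid E)"
  "sqh (D \<times>\<^sub>d E) = (\<lambda>(\<alpha>, \<alpha>') (\<beta>, \<beta>'). (sqh D \<alpha> \<beta>, sqh E \<alpha>' \<beta>'))"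
  "stop (D \<times>\<^sub>d E) = map_prod (stop D) (stop E)" "sbot (D \<times>\<^sub>d E) = map_prod (sbot D) (sbot E)"
  "sqvid (D \<times>\<^sub>d E) = map_prod (sqvid D) (sqvid E)"
  "sqv (D \<times>\<^sub>d E) = (\<lambda>(\<alpha>, \<alpha>') (\<beta>, \<beta>'). (sqv D \<alpha> \<beta>, sqv E \<alpha>' \<beta>'))"
  by (simp_all add: dblprod_def)

lemma V1_simps [simp]:
  "Obj (V1 D) = Obj D" "Hor (V1 D) = hid D ` Obj D" "Ver (V1 D) = Ver D"
  "Sq (V1 D) = sqhid D ` Ver D"
  "hdom (V1 D) = hdom D" "hcod (V1 D) = hcod D" "hid (V1 D) = hid D" "hcomp (V1 D) = hcomp D"
  "vdom (V1 D) = vdom D" "vcod (V1 D) = vcod D" "vid (V1 D) = vid D" "vcomp (V1 D) = vcomp D"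
  "sleft (V1 D) = sleft D" "sright (V1 D) = sright D" "sqhid (V1 D) = sqhid D"
  "sqh (V1 D) = sqh D"
  "stop (V1 D) = stop D" "sbot (V1 D) = sbot D" "sqvid (V1 D) = sqvid D" "sqv (V1 D) = sqv D"
  by (simp_all add: V1_def)

lemma double_category_horop:
  assumes "double_category D"
  shows "double_category (horop D)"
proof -
  interpret double_category D by fact
  show ?thesis
    by (rule double_category.intro)
      (simp_all add: small_category_opposite[OF hor_category] small_category_opposite[OF sqh_category]
        ver_category sqv_category double_category_simps sqhid_vid sqhid_vcomp sqvid_hcomp interchange)
qed

lemma double_category_product:
  assumes "double_category D" "double_category E"
  shows "double_category (D \<times>\<^sub>d E)"
proof -
  interpret D: double_category D by fact
  interpret E: double_category E by fact
  show ?thesis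
    by (rule double_category.intro)
      (auto simp:
        small_category_product[OF D.hor_category E.hor_category]
        small_category_product[OF D.ver_category E.ver_category]
        small_category_product[OF D.sqh_category E.sqh_category]
        small_category_product[OF D.sqv_category E.sqv_category]
        D.boundary_simps D.sqhid_vid D.sqhid_vcomp D.sqvid_hcomp D.interchange
        E.boundary_simps E.sqhid_vid E.sqhid_vcomp E.sqvid_hcomp E.interchange)
qed

lemma double_category_V1:
  assumes "double_category D"
  shows "double_category (V1 D)"
proof -
  interpret double_category D by fact
  have hid_sub: "hid D ` Obj D \<subseteq> Hor D" and sqhid_sub: "sqhid D ` Ver D \<subseteq> Sq D"
    by (auto simp: double_category_simps)
  have hid_hid: "hcomp D (hid D C) (hid D C) = hid D C" if "C \<in> Obj D" for C
    using hor.comp_ide_left[of "hid D C"] that by (simp add: hor.small_category_simps)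
  have sqhid_sqhid: "sqh D (sqhid D j) (sqhid D j) = sqhid D j" if "j \<in> Ver D" for j
    using sqh.comp_ide_left[of "sqhid D j"] that by (simp add: sqh.small_category_simps)
  \<comment> \<open>Two trivial squares fit vertically when the identities on
    \<open>vcod D j\<close> and \<open>vdom D k\<close> agree; injectivity of \<open>hid D\<close>
    turns this into composability of \<open>j\<close> and \<open>k\<close>, so the composite square
    is again trivial.\<close>
  have hid_eqD: "C = C'" if "hid D C = hid D C'" "C \<in> Obj D" "C' \<in> Obj D" for C C'
    using that by (metis hor.src_ide)
  have "small_category (Obj D) (hid D ` Obj D) (hdom D) (hcod D) (hid D) (hcomp D)"
    by (rule small_category_subset[OF hor_category hid_sub]) (auto simp: hid_hid hor.small_category_simps)
  moreover have "small_category (Ver D) (sqhid D ` Ver D) (sleft D) (sright D) (sqhid D) (sqh D)"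
    by (rule small_category_subset[OF sqh_category sqhid_sub]) (auto simp: sqhid_sqhid sqh.small_category_simps)
  \<comment> \<open>Here the objects shrink together with the arrows, so this is not a wide
    subcategory and is checked directly.\<close>
  moreover have "small_category (hid D ` Obj D) (sqhid D ` Ver D) (stop D) (sbot D) (sqvid D) (sqv D)"
  proof -
    have "\<alpha> \<in> sqhid D ` Ver D \<Longrightarrow> \<beta> \<in> sqhid D ` Ver D \<Longrightarrow> sbot D \<alpha> = stop D \<beta>
      \<Longrightarrow> sqv D \<alpha> \<beta> \<in> sqhid D ` Ver D" for \<alpha> \<beta>
      by (auto simp: stop_sqhid sbot_sqhid sqhid_vcomp[symmetric] ver.small_category_simps
          dest!: hid_eqD)
    then show ?thesis
      by unfold_locales
        (auto simp: stop_sqhid sbot_sqhid sqhid_vid[symmetric] ver.small_category_simps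
          sqv.small_category_simps sqhid_sub[THEN subsetD] hid_sub[THEN subsetD] sqv.comp_assoc)
  qed
  ultimately show ?thesis
    by (intro double_category.intro)
      (auto simp: ver_category boundary_simps sqhid_vid sqhid_vcomp sqvid_hcomp interchange
        hid_sub[THEN subsetD] sqhid_sub[THEN subsetD])
qed

section \<open>Double functors\<close>

sublocale double_functor \<subseteq>
  hor: category_functor "Obj D" "Hor D" "hdom D" "hcod D" "hid D" "hcomp D"
    "Obj E" "Hor E" "hdom E" "hcod E" "hid E" "hcomp E" "fobj F" "fhor F"
  by unfold_locales (simp_all add: fobj_closed fhor_closed hdom_fhor hcod_fhor fhor_hid fhor_hcomp)

sublocale double_functor \<subseteq>
  sqh: category_functor "Ver D" "Sq D" "sleft D" "sright D" "sqhid D" "sqh D"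
    "Ver E" "Sq E" "sleft E" "sright E" "sqhid E" "sqh E" "fver F" "fsq F"
  by unfold_locales (simp_all add: fver_closed fsq_closed sleft_fsq sright_fsq fsq_sqhid fsq_sqh)

lemmas (in double_functor) double_functor_simps =
  fobj_closed fhor_closed fver_closed fsq_closed hdom_fhor hcod_fhor vdom_fver vcod_fver
  sleft_fsq sright_fsq stop_fsq sbot_fsq fhor_hid fver_vid fsq_sqhid fsq_sqvid
  fhor_hcomp fver_vcomp fsq_sqh fsq_sqv

lemma dfun_id_simps [simp]:
  "fobj dfun_id = id" "fhor dfun_id = id" "fver dfun_id = id" "fsq dfun_id = id"
  by (simp_all add: dfun_id_def)

lemma dfun_comp_simps [simp]:
  "fobj (G \<circ>\<^sub>d F) = fobj G \<circ> fobj F" "fhor (G \<circ>\<^sub>d F) = fhor G \<circ> fhor F"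
  "fver (G \<circ>\<^sub>d F) = fver G \<circ> fver F" "fsq (G \<circ>\<^sub>d F) = fsq G \<circ> fsq F"
  by (simp_all add: dfun_comp_def)

lemma double_functor_id:
  assumes "double_category D"
  shows "double_functor D D dfun_id"
  using assms by (intro double_functor.intro double_functor_axioms.intro) simp_all

lemma double_functor_comp:
  assumes "double_functor D E F" "double_functor E H G"
  shows "double_functor D H (G \<circ>\<^sub>d F)"
proof -
  interpret F: double_functor D E F by fact
  interpret G: double_functor E H G by fact
  show ?thesis
    by unfold_locales (simp_all add: F.double_functor_simps G.double_functor_simps)
qed

text \<open>Restriction along the inclusion of \<open>V1 D\<close> changes only the carriers. For
  \<open>dfun_id\<close> it gives that inclusion itself, and for a right adjoint it gives the
  representing double functor.\<close>

lemma double_functor_V1: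
  assumes "double_functor D E F"
  shows "double_functor (V1 D) E F"
proof -
  interpret double_functor D E F by fact
  have "hid D C \<in> Hor D" if "C \<in> Obj D" for C using that by (rule D.hor.ide_closed)
  moreover have "sqhid D j \<in> Sq D" if "j \<in> Ver D" for j using that by (rule D.sqh.ide_closed)
  ultimately show ?thesis
    using double_category_V1[OF D.double_category_axioms] E.double_category_axioms
    by (intro double_functor.intro double_functor_axioms.intro)
      (auto simp: double_functor_simps D.double_category_simps E.double_category_simps)
qed

section \<open>Hom presheaves\<close>

lemma hom_presheaf_simps [simp]:
  "kobj (hom_presheaf A F H) (C, B) = {x \<in> Hor A. hdom A x = fobj F C \<and> hcod A x = fobj H B}"
  "khor (hom_presheaf A F H) (f, e) x = hcomp A (hcomp A (fhor F f) x) (fhor H e)"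
  "kver (hom_presheaf A F H) (j, k) = {\<xi> \<in> Sq A. sleft A \<xi> = fver F j \<and> sright A \<xi> = fver H k}"
  "ktop (hom_presheaf A F H) jk = stop A" "kbot (hom_presheaf A F H) jk = sbot A"
  "ksq (hom_presheaf A F H) (\<alpha>, \<beta>) \<xi> = sqh A (sqh A (fsq F \<alpha>) \<xi>) (fsq H \<beta>)"
  "kcomp (hom_presheaf A F H) jk jk' = sqv A" "kunit (hom_presheaf A F H) CB = sqvid A"
  by (simp_all add: hom_presheaf_def)

text \<open>Functoriality is associativity of horizontal composition. Naturality of the comparison
  maps is interchange for composites and \<open>sqvid_hcomp\<close> for units; their coherence laws
  are the laws of vertical composition of squares.\<close>

lemma parameterized_presheaf_hom:
  assumes "double_functor X A F" "double_functor E A H"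
  shows "parameterized_presheaf X E (hom_presheaf A F H)"
proof -
  interpret F: double_functor X A F by fact
  interpret H: double_functor E A H by fact
  \<comment> \<open>The unit laws are restated with the boundary as a premise, so that they apply
    where an identity is indexed by an image such as \<open>fobj F c\<close> instead of
    \<open>hdom A x\<close>.\<close>
  have hid_left: "hcomp A (hid A a) x = x" if "x \<in> Hor A" "hdom A x = a" for a x
    using that F.E.hor.comp_ide_left by auto
  have hid_right: "hcomp A x (hid A b) = x" if "x \<in> Hor A" "hcod A x = b" for b x
    using that F.E.hor.comp_ide_right by auto
  have sqhid_left: "sqh A (sqhid A j) \<xi> = \<xi>" if "\<xi> \<in> Sq A" "sleft A \<xi> = j" for j \<xi>
    using that F.E.sqh.comp_ide_left by auto
  have sqhid_right: "sqh A \<xi> (sqhid A j) = \<xi>" if "\<xi> \<in> Sq A" "sright A \<xi> = j" for j \<xi>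
    using that F.E.sqh.comp_ide_right by auto
  show ?thesis
    by (intro lax_span_functor.intro lax_span_functor_axioms.intro double_category_product
        double_category_horop F.D.double_category_axioms H.D.double_category_axioms)
      (auto simp: F.double_functor_simps H.double_functor_simps F.E.double_category_simps
        F.D.double_category_simps H.D.double_category_simps
        F.E.hor.comp_assoc F.E.sqh.comp_assoc F.E.sqv.comp_assoc F.E.sqvid_hcomp F.E.interchange
        hid_left hid_right sqhid_left sqhid_right)
qed

text \<open>
  Since \<open>V1 P\<close> has no horizontal structure, naturality of a morphism between hom presheaves
  parameterized by it is only a condition in the variable from \<open>X\<close>.
\<close>

locale transposition =
  fixes X :: "('ox, 'hx, 'vx, 'sx) dblcat" and P :: "('op, 'hp, 'vp, 'sp) dblcat"
    and A :: "('oa, 'ha, 'va, 'sa) dblcat" and B :: "('ob, 'hb, 'vb, 'sb) dblcat"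
    and F :: "('ox, 'hx, 'vx, 'sx, 'oa, 'ha, 'va, 'sa) dblfun"
    and H :: "('op, 'hp, 'vp, 'sp, 'oa, 'ha, 'va, 'sa) dblfun"
    and F' :: "('ox, 'hx, 'vx, 'sx, 'ob, 'hb, 'vb, 'sb) dblfun"
    and H' :: "('op, 'hp, 'vp, 'sp, 'ob, 'hb, 'vb, 'sb) dblfun"
    and \<phi> :: "('ox \<times> 'op, 'vx \<times> 'vp, 'ha, 'sa, 'hb, 'sb) spantrans"
  assumes mobj_hom: "\<lbrakk>c \<in> Obj X; b \<in> Obj P; x \<in> Hor A; hdom A x = fobj F c; hcod A x = fobj H b\<rbrakk>
      \<Longrightarrow> mobj \<phi> (c, b) x \<in> Hor B \<and> hdom B (mobj \<phi> (c, b) x) = fobj F' c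
        \<and> hcod B (mobj \<phi> (c, b) x) = fobj H' b"
    and mver_hom: "\<lbrakk>j \<in> Ver X; k \<in> Ver P; \<xi> \<in> Sq A; sleft A \<xi> = fver F j; sright A \<xi> = fver H k\<rbrakk>
      \<Longrightarrow> mver \<phi> (j, k) \<xi> \<in> Sq B \<and> sleft B (mver \<phi> (j, k) \<xi>) = fver F' j
        \<and> sright B (mver \<phi> (j, k) \<xi>) = fver H' k"
    and stop_mver: "\<lbrakk>j \<in> Ver X; k \<in> Ver P; \<xi> \<in> Sq A; sleft A \<xi> = fver F j; sright A \<xi> = fver H k\<rbrakk>
      \<Longrightarrow> stop B (mver \<phi> (j, k) \<xi>) = mobj \<phi> (vdom X j, vdom P k) (stop A \<xi>)"
    and sbot_mver: "\<lbrakk>j \<in> Ver X; k \<in> Ver P; \<xi> \<in> Sq A; sleft A \<xi> = fver F j; sright A \<xi> = fver H k\<rbrakk>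
      \<Longrightarrow> sbot B (mver \<phi> (j, k) \<xi>) = mobj \<phi> (vcod X j, vcod P k) (sbot A \<xi>)"
    and mobj_natural: "\<lbrakk>u \<in> Hor X; b \<in> Obj P; x \<in> Hor A; hdom A x = fobj F (hcod X u);
        hcod A x = fobj H b\<rbrakk>
      \<Longrightarrow> mobj \<phi> (hdom X u, b) (hcomp A (fhor F u) x)
        = hcomp B (fhor F' u) (mobj \<phi> (hcod X u, b) x)"
    and mver_natural: "\<lbrakk>\<alpha> \<in> Sq X; k \<in> Ver P; \<xi> \<in> Sq A; sleft A \<xi> = fver F (sright X \<alpha>);
        sright A \<xi> = fver H k\<rbrakk>
      \<Longrightarrow> mver \<phi> (sleft X \<alpha>, k) (sqh A (fsq F \<alpha>) \<xi>)
        = sqh B (fsq F' \<alpha>) (mver \<phi> (sright X \<alpha>, k) \<xi>)"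
    and mver_sqv: "\<lbrakk>j \<in> Ver X; j' \<in> Ver X; vcod X j = vdom X j';
        k \<in> Ver P; k' \<in> Ver P; vcod P k = vdom P k';
        \<xi> \<in> Sq A; sleft A \<xi> = fver F j; sright A \<xi> = fver H k;
        \<xi>' \<in> Sq A; sleft A \<xi>' = fver F j'; sright A \<xi>' = fver H k'; sbot A \<xi> = stop A \<xi>'\<rbrakk>
      \<Longrightarrow> mver \<phi> (vcomp X j j', vcomp P k k') (sqv A \<xi> \<xi>')
        = sqv B (mver \<phi> (j, k) \<xi>) (mver \<phi> (j', k') \<xi>')"
    and mver_sqvid: "\<lbrakk>c \<in> Obj X; b \<in> Obj P; x \<in> Hor A; hdom A x = fobj F c; hcod A x = fobj H b\<rbrakk>
      \<Longrightarrow> mver \<phi> (vid X c, vid P b) (sqvid A x) = sqvid B (mobj \<phi> (c, b) x)"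

text \<open>Horizontal morphisms and squares of \<open>V1 P\<close> are identities, which
  \<open>H\<close> and \<open>H'\<close> preserve, so the right-hand factors in the presheaf actions
  cancel. The functors are kept general so that the result covers both a transposition and its
  inverse.\<close>

lemma presheaf_morphism_hom_iff:
  assumes "double_category P"
    and "double_functor X A F" "double_functor (V1 P) A H"
    and "double_functor X B F'" "double_functor (V1 P) B H'"
  shows "presheaf_morphism X (V1 P) (hom_presheaf A F H) (hom_presheaf B F' H') \<phi>
    \<longleftrightarrow> transposition X P A B F H F' H' \<phi>"
proof -
  interpret P: double_category P by fact
  interpret F: double_functor X A F by fact
  interpret H: double_functor "V1 P" A H by fact
  interpret F': double_functor X B F' by fact
  interpret H': double_functor "V1 P" B H' by fact
  have fhor_hid: "fhor H (hid P b) = hid A (fobj H b)" "fhor H' (hid P b) = hid B (fobj H' b)"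
    if "b \<in> Obj P" for b
    using that H.fhor_hid H'.fhor_hid by simp_all
  have fsq_sqhid: "fsq H (sqhid P k) = sqhid A (fver H k)" "fsq H' (sqhid P k) = sqhid B (fver H' k)"
    if "k \<in> Ver P" for k
    using that H.fsq_sqhid H'.fsq_sqhid by simp_all
  have hid_right: "hcomp A x (hid A b) = x" if "x \<in> Hor A" "hcod A x = b" for b x
    using that F.E.hor.comp_ide_right by auto
  have hid_right': "hcomp B x (hid B b) = x" if "x \<in> Hor B" "hcod B x = b" for b x
    using that F'.E.hor.comp_ide_right by auto
  have sqhid_right: "sqh A \<xi> (sqhid A j) = \<xi>" if "\<xi> \<in> Sq A" "sright A \<xi> = j" for j \<xi>
    using that F.E.sqh.comp_ide_right by auto
  have sqhid_right': "sqh B \<xi> (sqhid B j) = \<xi>" if "\<xi> \<in> Sq B" "sright B \<xi> = j" for j \<xi>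
    using that F'.E.sqh.comp_ide_right by auto
  note right_simps = fhor_hid fsq_sqhid hid_right hid_right' sqhid_right sqhid_right'
    F.double_functor_simps F'.double_functor_simps P.hor.small_category_simps
    P.sqh.small_category_simps F.E.double_category_simps F'.E.double_category_simps
    F.D.double_category_simps
  show ?thesis
  proof
    assume "presheaf_morphism X (V1 P) (hom_presheaf A F H) (hom_presheaf B F' H') \<phi>"
    then interpret T: lax_span_transformation "horop X \<times>\<^sub>d V1 P" "hom_presheaf A F H"
      "hom_presheaf B F' H'" \<phi> .
    have mobj_hom: "mobj \<phi> (c, b) x \<in> Hor B \<and> hdom B (mobj \<phi> (c, b) x) = fobj F' c
        \<and> hcod B (mobj \<phi> (c, b) x) = fobj H' b"
      if "c \<in> Obj X" "b \<in> Obj P" "x \<in> Hor A" "hdom A x = fobj F c" "hcod A x = fobj H b" for c b x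
      using T.mobj_closed[of "(c, b)" x] that by simp
    have mver_hom: "mver \<phi> (j, k) \<xi> \<in> Sq B \<and> sleft B (mver \<phi> (j, k) \<xi>) = fver F' j
        \<and> sright B (mver \<phi> (j, k) \<xi>) = fver H' k"
      if "j \<in> Ver X" "k \<in> Ver P" "\<xi> \<in> Sq A" "sleft A \<xi> = fver F j" "sright A \<xi> = fver H k" for j k \<xi>
      using T.mver_closed[of "(j, k)" \<xi>] that by simp
    show "transposition X P A B F H F' H' \<phi>"
    proof
      fix u b x
      assume "u \<in> Hor X" "b \<in> Obj P" "x \<in> Hor A" "hdom A x = fobj F (hcod X u)" "hcod A x = fobj H b"
      then show "mobj \<phi> (hdom X u, b) (hcomp A (fhor F u) x)
        = hcomp B (fhor F' u) (mobj \<phi> (hcod X u, b) x)"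
        \<comment> \<open>Naturality in the first variable is joint naturality with an identity in
          the second.\<close>
        using T.mobj_natural[of "(u, hid P b)" x] mobj_hom[of "hcod X u" b x]
        by (simp add: right_simps)
    next
      fix \<alpha> k \<xi>
      assume "\<alpha> \<in> Sq X" "k \<in> Ver P" "\<xi> \<in> Sq A" "sleft A \<xi> = fver F (sright X \<alpha>)"
        "sright A \<xi> = fver H k"
      then show "mver \<phi> (sleft X \<alpha>, k) (sqh A (fsq F \<alpha>) \<xi>)
        = sqh B (fsq F' \<alpha>) (mver \<phi> (sright X \<alpha>, k) \<xi>)"
        using T.mver_natural[of "(\<alpha>, sqhid P k)" \<xi>] mver_hom[of "sright X \<alpha>" k \<xi>]
        by (simp add: right_simps)
    next
      fix j j' k k' \<xi> \<xi>'
      assume "j \<in> Ver X" "j' \<in> Ver X" "vcod X j = vdom X j'"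
        "k \<in> Ver P" "k' \<in> Ver P" "vcod P k = vdom P k'"
        "\<xi> \<in> Sq A" "sleft A \<xi> = fver F j" "sright A \<xi> = fver H k"
        "\<xi>' \<in> Sq A" "sleft A \<xi>' = fver F j'" "sright A \<xi>' = fver H k'" "sbot A \<xi> = stop A \<xi>'"
      then show "mver \<phi> (vcomp X j j', vcomp P k k') (sqv A \<xi> \<xi>')
        = sqv B (mver \<phi> (j, k) \<xi>) (mver \<phi> (j', k') \<xi>')"
        using T.mver_kcomp[of "(j, k)" "(j', k')" \<xi> \<xi>'] by simp
    qed (use mobj_hom mver_hom T.ktop_mver T.kbot_mver T.mver_kunit in auto)
  next
    assume "transposition X P A B F H F' H' \<phi>"
    then interpret T: transposition X P A B F H F' H' \<phi> .
    show "presheaf_morphism X (V1 P) (hom_presheaf A F H) (hom_presheaf B F' H') \<phi>"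
    \<comment> \<open>Conversely, every horizontal morphism and square of the product has an
      identity as its second component, so naturality in the first variable is all that has to be
      supplied.\<close>
    proof (intro lax_span_transformation.intro lax_span_transformation_axioms.intro
        parameterized_presheaf_hom assms(2-))
    qed (auto simp: T.mobj_hom T.mver_hom T.stop_mver T.sbot_mver T.mobj_natural T.mver_natural
      T.mver_sqv T.mver_sqvid right_simps)
  qed
qed

section \<open>From adjunctions to representations\<close>

lemma (in horizontal_transformation) tobj_natural:
  assumes "f \<in> Hor D"
  shows "hcomp E (fhor F f) (tobj \<theta> (hcod D f)) = hcomp E (tobj \<theta> (hdom D f)) (fhor G f)"
proof -
  have "stop E (sqh E (fsq F (sqvid D f)) (tver \<theta> (sright D (sqvid D f))))
    = stop E (sqh E (tver \<theta> (sleft D (sqvid D f))) (fsq G (sqvid D f)))"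
    using assms naturality[of "sqvid D f"] by (simp add: F.D.double_category_simps)
  then show ?thesis
    using assms
    by (simp add: F.D.double_category_simps F.E.double_category_simps F.double_functor_simps
        G.double_functor_simps tver_closed sleft_tver sright_tver stop_tver)
qed

lemmas (in horizontal_transformation) transformation_simps =
  tobj_closed hdom_tobj hcod_tobj tver_closed sleft_tver sright_tver stop_tver sbot_tver tver_vid

context horizontal_double_adjunction
begin

text \<open>The object components of the triangle identities give this adjunction; their components
  at vertical morphisms give the one on squares.\<close>

lemma hor_adjunction:
  "category_adjunction (Obj X) (Hor X) (hdom X) (hcod X) (hid X) (hcomp X)
     (Obj A) (Hor A) (hdom A) (hcod A) (hid A) (hcomp A)
     (fobj F) (fhor F) (fobj G) (fhor G) (tobj \<eta>) (tobj \<epsilon>)"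
  using unit.tobj_natural counit.tobj_natural triangle_left triangle_right
  by unfold_locales
    (simp_all add: unit.transformation_simps counit.transformation_simps htrans_eq_def
      htrans_comp_def htrans_id_def whisker_post_def whisker_pre_def)

lemma sqh_adjunction:
  "category_adjunction (Ver X) (Sq X) (sleft X) (sright X) (sqhid X) (sqh X)
     (Ver A) (Sq A) (sleft A) (sright A) (sqhid A) (sqh A)
     (fver F) (fsq F) (fver G) (fsq G) (tver \<eta>) (tver \<epsilon>)"
  using unit.naturality counit.naturality triangle_left triangle_right
  by unfold_locales
    (simp_all add: unit.transformation_simps counit.transformation_simps htrans_eq_def
      htrans_comp_def htrans_id_def whisker_post_def whisker_pre_def)

lemma represented_by_right_adjoint:
  "represented_by X (V1 A) (left_hom_presheaf A F) G"
proof -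
  interpret hor: category_adjunction "Obj X" "Hor X" "hdom X" "hcod X" "hid X" "hcomp X"
    "Obj A" "Hor A" "hdom A" "hcod A" "hid A" "hcomp A"
    "fobj F" "fhor F" "fobj G" "fhor G" "tobj \<eta>" "tobj \<epsilon>"
    by (rule hor_adjunction)
  interpret sqh: category_adjunction "Ver X" "Sq X" "sleft X" "sright X" "sqhid X" "sqh X"
    "Ver A" "Sq A" "sleft A" "sright A" "sqhid A" "sqh A"
    "fver F" "fsq F" "fver G" "fsq G" "tver \<eta>" "tver \<epsilon>"
    by (rule sqh_adjunction)
  define \<phi> where "\<phi> =
    \<lparr>mobj = (\<lambda>(c :: 'ox, b :: 'oa) x. hor.\<phi> c x), mver = (\<lambda>(j :: 'vx, k :: 'va) \<xi>. sqh.\<phi> j \<xi>)\<rparr>"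
  define \<psi> where "\<psi> =
    \<lparr>mobj = (\<lambda>(c :: 'ox, b :: 'oa) y. hor.\<psi> b y), mver = (\<lambda>(j :: 'vx, k :: 'va) \<xi>. sqh.\<psi> k \<xi>)\<rparr>"
  have \<phi>_simps: "mobj \<phi> (c, b) x = hor.\<phi> c x" "mver \<phi> (j, k) \<xi> = sqh.\<phi> j \<xi>" for c b x j k \<xi>
    by (simp_all add: \<phi>_def)
  have \<psi>_simps: "mobj \<psi> (c, b) y = hor.\<psi> b y" "mver \<psi> (j, k) \<zeta> = sqh.\<psi> k \<zeta>" for c b y j k \<zeta>
    by (simp_all add: \<psi>_def)
  note simps = F.double_functor_simps G.double_functor_simps F.D.double_category_simps
    F.E.double_category_simps unit.transformation_simps counit.transformation_simps
    unit.tver_vcomp counit.tver_vcomp F.D.interchange F.E.interchange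
    F.D.sqvid_hcomp F.E.sqvid_hcomp
  \<comment> \<open>The hom set and naturality conditions are those of the two adjunctions.
    Boundaries and vertical composition involve both levels at once and are computed from the
    formulas, using interchange.\<close>
  have "transposition X A A X F dfun_id dfun_id G \<phi>"
    by unfold_locales
      (simp_all add: \<phi>_simps hor.\<phi>_hom sqh.\<phi>_hom hor.\<phi>_natural sqh.\<phi>_natural,
       simp_all add: hor.\<phi>_def sqh.\<phi>_def simps)
  moreover have "transposition X A X A dfun_id G F dfun_id \<psi>"
    by unfold_locales
      (simp_all add: \<psi>_simps hor.\<psi>_hom sqh.\<psi>_hom hor.\<psi>_natural sqh.\<psi>_natural,
       simp_all add: hor.\<psi>_def sqh.\<psi>_def simps)
  ultimately have "presheaf_morphism X (V1 A) (left_hom_presheaf A F) (right_hom_presheaf X G) \<phi>"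
    and "presheaf_morphism X (V1 A) (right_hom_presheaf X G) (left_hom_presheaf A F) \<psi>"
    by (simp_all add: presheaf_morphism_hom_iff F.D.double_category_axioms
        F.E.double_category_axioms F.double_functor_axioms G.double_functor_axioms
        double_functor_id double_functor_V1)
  moreover have "spantrans_eq (horop X \<times>\<^sub>d V1 A) (left_hom_presheaf A F)
      (spantrans_comp \<phi> \<psi>) spantrans_id"
    using hor.\<psi>_\<phi> sqh.\<psi>_\<phi>
    by (auto simp: spantrans_eq_def spantrans_comp_def spantrans_id_def \<phi>_simps \<psi>_simps)
  moreover have "spantrans_eq (horop X \<times>\<^sub>d V1 A) (right_hom_presheaf X G)
      (spantrans_comp \<psi> \<phi>) spantrans_id"
    using hor.\<phi>_\<psi> sqh.\<phi>_\<psi>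
    by (auto simp: spantrans_eq_def spantrans_comp_def spantrans_id_def \<phi>_simps \<psi>_simps)
  ultimately show ?thesis
    unfolding represented_by_def presheaf_isomorphic_def
    by (blast intro: double_functor_V1 G.double_functor_axioms)
qed

end

section \<open>From representations to adjunctions\<close>

lemma has_right_adjoint_if_represented:
  assumes "double_functor X A F" and "represented_by X (V1 A) (left_hom_presheaf A F) G0"
  shows "has_horizontal_right_double_adjoint X A F"
proof -
  interpret F: double_functor X A F by fact
  interpret G0: double_functor "V1 A" X G0
    using assms(2) by (simp add: represented_by_def)
  obtain \<phi> \<psi> where
    "presheaf_morphism X (V1 A) (left_hom_presheaf A F) (right_hom_presheaf X G0) \<phi>"
    "presheaf_morphism X (V1 A) (right_hom_presheaf X G0) (left_hom_presheaf A F) \<psi>"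
    and inverse: "spantrans_eq (horop X \<times>\<^sub>d V1 A) (left_hom_presheaf A F)
      (spantrans_comp \<phi> \<psi>) spantrans_id"
    "spantrans_eq (horop X \<times>\<^sub>d V1 A) (right_hom_presheaf X G0)
      (spantrans_comp \<psi> \<phi>) spantrans_id"
    using assms(2) by (auto simp: represented_by_def presheaf_isomorphic_def)
  then have "transposition X A A X F dfun_id dfun_id G0 \<phi>"
    and "transposition X A X A dfun_id G0 F dfun_id \<psi>"
    by (simp_all add: presheaf_morphism_hom_iff F.D.double_category_axioms
        F.E.double_category_axioms F.double_functor_axioms G0.double_functor_axioms
        double_functor_id double_functor_V1)
  then interpret \<phi>: transposition X A A X F dfun_id dfun_id G0 \<phi>
    + \<psi>: transposition X A X A dfun_id G0 F dfun_id \<psi> .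
  have mobj_inverse:
    "\<lbrakk>c \<in> Obj X; b \<in> Obj A; x \<in> Hor A; hdom A x = fobj F c; hcod A x = b\<rbrakk>
      \<Longrightarrow> mobj \<psi> (c, b) (mobj \<phi> (c, b) x) = x"
    "\<lbrakk>c \<in> Obj X; b \<in> Obj A; y \<in> Hor X; hdom X y = c; hcod X y = fobj G0 b\<rbrakk>
      \<Longrightarrow> mobj \<phi> (c, b) (mobj \<psi> (c, b) y) = y" for c b x y
    using inverse by (auto simp: spantrans_eq_def spantrans_comp_def spantrans_id_def)
  have mver_inverse:
    "\<lbrakk>j \<in> Ver X; k \<in> Ver A; \<xi> \<in> Sq A; sleft A \<xi> = fver F j; sright A \<xi> = k\<rbrakk>
      \<Longrightarrow> mver \<psi> (j, k) (mver \<phi> (j, k) \<xi>) = \<xi>"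
    "\<lbrakk>j \<in> Ver X; k \<in> Ver A; \<zeta> \<in> Sq X; sleft X \<zeta> = j; sright X \<zeta> = fver G0 k\<rbrakk>
      \<Longrightarrow> mver \<phi> (j, k) (mver \<psi> (j, k) \<zeta>) = \<zeta>" for j k \<xi> \<zeta>
    using inverse by (auto simp: spantrans_eq_def spantrans_comp_def spantrans_id_def)
  \<comment> \<open>\<open>V1 A\<close> and \<open>A\<close> share objects and vertical morphisms,
    so these facts about \<open>G0\<close> can be read in \<open>A\<close>. On general horizontal
    morphisms and squares of \<open>A\<close> the double functor \<open>G0\<close> gives no
    information.\<close>
  note G0_simps = G0.fobj_closed[simplified] G0.fver_closed[simplified]
    G0.vdom_fver[simplified] G0.vcod_fver[simplified]
    G0.fver_vid[simplified] G0.fver_vcomp[simplified]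
  interpret hor: category_representation "Obj X" "Hor X" "hdom X" "hcod X" "hid X" "hcomp X"
    "Obj A" "Hor A" "hdom A" "hcod A" "hid A" "hcomp A" "fobj F" "fhor F" "fobj G0"
    "\<lambda>c b. mobj \<phi> (c, b)" "\<lambda>c b. mobj \<psi> (c, b)"
    using \<phi>.mobj_hom \<psi>.mobj_hom \<phi>.mobj_natural \<psi>.mobj_natural
    by unfold_locales (simp_all add: G0_simps mobj_inverse)
  interpret sqh: category_representation "Ver X" "Sq X" "sleft X" "sright X" "sqhid X" "sqh X"
    "Ver A" "Sq A" "sleft A" "sright A" "sqhid A" "sqh A" "fver F" "fsq F" "fver G0"
    "\<lambda>j k. mver \<phi> (j, k)" "\<lambda>j k. mver \<psi> (j, k)"
    using \<phi>.mver_hom \<psi>.mver_hom \<phi>.mver_natural \<psi>.mver_natural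
    by unfold_locales (simp_all add: G0_simps mver_inverse)
  note simps = F.double_functor_simps F.D.double_category_simps F.E.double_category_simps G0_simps
  \<comment> \<open>The counit at \<open>k\<close> is the transpose of the identity square on
    \<open>fver G0 k\<close>, whose top and bottom are identities; transposition respects
    boundaries. In the same way the vertical laws for identity squares give those of the counit and,
    dually, of the unit.\<close>
  have counit_boundary: "stop A (sqh.counit k) = hor.counit (vdom A k)"
    "sbot A (sqh.counit k) = hor.counit (vcod A k)" if "k \<in> Ver A" for k
    using that by (simp_all add: sqh.counit_def hor.counit_def \<psi>.stop_mver \<psi>.sbot_mver simps)
  have unit_boundary: "stop X (sqh.unit j) = hor.unit (vdom X j)"
    "sbot X (sqh.unit j) = hor.unit (vcod X j)" if "j \<in> Ver X" for j
    using that by (simp_all add: sqh.unit_def hor.unit_def \<phi>.stop_mver \<phi>.sbot_mver simps)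
  have counit_vid: "sqh.counit (vid A b) = sqvid A (hor.counit b)" if "b \<in> Obj A" for b
    using that
    by (simp add: sqh.counit_def hor.counit_def F.D.sqhid_vid \<psi>.mver_sqvid simps)
  have unit_vid: "sqh.unit (vid X c) = sqvid X (hor.unit c)" if "c \<in> Obj X" for c
    using that
    by (simp add: sqh.unit_def hor.unit_def F.E.sqhid_vid \<phi>.mver_sqvid simps)
  have counit_vcomp: "sqh.counit (vcomp A k k') = sqv A (sqh.counit k) (sqh.counit k')"
    if "k \<in> Ver A" "k' \<in> Ver A" "vcod A k = vdom A k'" for k k'
    using that by (simp add: sqh.counit_def F.D.sqhid_vcomp \<psi>.mver_sqv simps)
  have unit_vcomp: "sqh.unit (vcomp X j j') = sqv X (sqh.unit j) (sqh.unit j')"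
    if "j \<in> Ver X" "j' \<in> Ver X" "vcod X j = vdom X j'" for j j'
    using that by (simp add: sqh.unit_def F.E.sqhid_vcomp \<phi>.mver_sqv simps)
  have Ga_boundary: "stop X (sqh.Ga \<alpha>) = hor.Ga (stop A \<alpha>)" "sbot X (sqh.Ga \<alpha>) = hor.Ga (sbot A \<alpha>)"
    if "\<alpha> \<in> Sq A" for \<alpha>
    using that
    by (simp_all add: sqh.Ga_def hor.Ga_def \<phi>.stop_mver \<phi>.sbot_mver simps sqh.counit_hom
        counit_boundary)
  have Ga_sqvid: "sqh.Ga (sqvid A h) = sqvid X (hor.Ga h)" if "h \<in> Hor A" for h
    using that
    by (simp add: sqh.Ga_def hor.Ga_def \<phi>.mver_sqvid simps hor.counit_hom counit_vid
        F.E.sqvid_hcomp[symmetric])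
  have Ga_sqv: "sqh.Ga (sqv A \<alpha> \<beta>) = sqv X (sqh.Ga \<alpha>) (sqh.Ga \<beta>)"
    if "\<alpha> \<in> Sq A" "\<beta> \<in> Sq A" "sbot A \<alpha> = stop A \<beta>" for \<alpha> \<beta>
  proof -
    \<comment> \<open>The shared edge of the squares has the same corners seen from above and below,
      so their sides compose. The counit at the composite left side then splits, and interchange
      separates the two transposed squares.\<close>
    have "vcod A (sleft A \<alpha>) = vdom A (sleft A \<beta>)" "vcod A (sright A \<alpha>) = vdom A (sright A \<beta>)"
      using that by (simp_all flip: F.E.corner_top_left F.E.corner_top_right F.E.corner_bot_left
          F.E.corner_bot_right)
    then show ?thesis
      using that
      by (simp add: sqh.Ga_def simps sqh.counit_hom counit_vcomp counit_boundary
          F.E.interchange[symmetric] \<phi>.mver_sqv)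
  qed

  \<comment> \<open>On identities \<open>hor.Ga\<close> and \<open>sqh.Ga\<close> give identities,
    so \<open>G\<close> agrees with \<open>G0\<close> on \<open>V1 A\<close>.\<close>
  define G where "G = \<lparr>fobj = fobj G0, fhor = hor.Ga, fver = fver G0, fsq = sqh.Ga\<rparr>"
  define \<eta> where "\<eta> = \<lparr>tobj = hor.unit, tver = sqh.unit\<rparr>"
  define \<epsilon> where "\<epsilon> = \<lparr>tobj = hor.counit, tver = sqh.counit\<rparr>"
  have G_simps [simp]: "fobj G = fobj G0" "fhor G = hor.Ga" "fver G = fver G0" "fsq G = sqh.Ga"
    by (simp_all add: G_def)
  have \<eta>_simps [simp]: "tobj \<eta> = hor.unit" "tver \<eta> = sqh.unit"
    by (simp_all add: \<eta>_def)
  have \<epsilon>_simps [simp]: "tobj \<epsilon> = hor.counit" "tver \<epsilon> = sqh.counit"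
    by (simp_all add: \<epsilon>_def)
  interpret G: double_functor A X G
    by unfold_locales
      (simp_all add: G0_simps hor.Ga_hom sqh.Ga_hom Ga_boundary hor.Ga_ide sqh.Ga_ide
        hor.Ga_comp sqh.Ga_comp Ga_sqvid Ga_sqv)
  have "horizontal_transformation X X dfun_id (G \<circ>\<^sub>d F) \<eta>"
    by (intro horizontal_transformation.intro horizontal_transformation_axioms.intro
        double_functor_id double_functor_comp[OF F.double_functor_axioms G.double_functor_axioms]
        F.D.double_category_axioms)
      (simp_all add: hor.unit_hom sqh.unit_hom unit_boundary unit_vid unit_vcomp sqh.unit_natural)
  moreover have "horizontal_transformation A A (F \<circ>\<^sub>d G) dfun_id \<epsilon>"
    by (intro horizontal_transformation.intro horizontal_transformation_axioms.intro
        double_functor_id double_functor_comp[OF G.double_functor_axioms F.double_functor_axioms]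
        F.E.double_category_axioms)
      (simp_all add: hor.counit_hom sqh.counit_hom counit_boundary counit_vid counit_vcomp
        sqh.counit_natural)
  ultimately have "horizontal_double_adjunction X A F G \<eta> \<epsilon>"
    by (intro horizontal_double_adjunction.intro horizontal_double_adjunction_axioms.intro
        F.double_functor_axioms G.double_functor_axioms)
      (simp_all add: htrans_eq_def htrans_comp_def htrans_id_def whisker_post_def whisker_pre_def
        hor.triangle_left sqh.triangle_left hor.triangle_right sqh.triangle_right)
  then show ?thesis
    by (auto simp: has_horizontal_right_double_adjoint_def)
qed

theorem theorem5p5:
  fixes X :: "('ox, 'hx, 'vx, 'sx) dblcat"
    and A :: "('oa, 'ha, 'va, 'sa) dblcat"
    and F :: "('ox, 'hx, 'vx, 'sx, 'oa, 'ha, 'va, 'sa) dblfun"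
  assumes "double_category X"
    and "double_category A"
    and "double_functor X A F"
  shows "has_horizontal_right_double_adjoint X A F \<longleftrightarrow>
    (\<exists>G0. represented_by X (V1 A) (left_hom_presheaf A F) G0)"
  \<comment> \<open>In the forward direction the right adjoint itself, regarded on
    \<open>V1 A\<close>, is the witness \<open>G0\<close>.\<close>
  using has_right_adjoint_if_represented[OF assms(3)]
    horizontal_double_adjunction.represented_by_right_adjoint
  by (fastforce simp: has_horizontal_right_double_adjoint_def)

end
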